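(* Let $\mathsf V$ be an equidivisible pseudovariety of semigroups and $A$ an arbitrary (possibly infinite) alphabet. Let $x\in\overline{\Omega}_A\mathsf V$. Then the monoid $\mathrm{Stab}(x)$ is an internal $\mathcal L$-chain, and its internally regular elements are idempotents.
   Context: $\overline{\Omega}_A\mathsf V$ is the free pro-$\mathsf V$ semigroup over $A$ (a pseudovariety of semigroups is a class of finite semigroups closed under subsemigroups, homomorphic images and finite direct products). A semigroup $S$ is equidivisible if whenever $uv=xy$ there is $t\in S^1$ with ($ut=x$ and $v=ty$) or ($xt=u$ and $y=tv$); $\mathsf V$ is equidivisible if $\overline{\Omega}_A\mathsf V$ is equidivisible for every finite alphabet $A$. For $x\in S$, $\mathrm{Stab}(x)=\{y\in S^1: xy=x\}$, where $S^1$ is $S$ with an identity adjoined. A submonoid $T$ is an internal $\mathcal L$-chain if for all $y,z\in T$, $y\in Tz\cup\{z\}$ or $z\in Ty\cup\{y\}$ (i.e. $y\le_{\mathcal L(T)}z$ or $z\le_{\mathcal L(T)}y$, computed in $T$); $y\in T$ is internally regular if $y\in yTy$. *)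

theory Defs
  imports Main "HOL-Library.Nat_Bijection"
begin

text \<open>Finite semigroups are encoded with carrier a set of naturals (every finite
semigroup is isomorphic to such a one).\<close>

definition is_fsgp :: "nat set \<Rightarrow> (nat \<Rightarrow> nat \<Rightarrow> nat) \<Rightarrow> bool" where
  "is_fsgp S m \<longleftrightarrow> finite S \<and> S \<noteq> {} \<and> (\<forall>a\<in>S. \<forall>b\<in>S. m a b \<in> S) \<and>
     (\<forall>a\<in>S. \<forall>b\<in>S. \<forall>c\<in>S. m (m a b) c = m a (m b c))"

definition prod_sgp_mult :: "(nat \<Rightarrow> nat \<Rightarrow> nat) \<Rightarrow> (nat \<Rightarrow> nat \<Rightarrow> nat) \<Rightarrow> nat \<Rightarrow> nat \<Rightarrow> nat" where
  "prod_sgp_mult m n a b = prod_encode (m (fst (prod_decode a)) (fst (prod_decode b)),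
                                         n (snd (prod_decode a)) (snd (prod_decode b)))"

definition pseudovariety :: "(nat set \<times> (nat \<Rightarrow> nat \<Rightarrow> nat)) set \<Rightarrow> bool" where
  "pseudovariety V \<longleftrightarrow> V \<noteq> {} \<and>
     (\<forall>(S, m)\<in>V. is_fsgp S m) \<and>
     (\<forall>(S, m)\<in>V. \<forall>T. T \<noteq> {} \<and> T \<subseteq> S \<and> (\<forall>a\<in>T. \<forall>b\<in>T. m a b \<in> T) \<longrightarrow> (T, m) \<in> V) \<and>
     (\<forall>(S, m)\<in>V. \<forall>T n h. h ` S = T \<and> (\<forall>a\<in>S. \<forall>b\<in>S. h (m a b) = n (h a) (h b))
         \<longrightarrow> (T, n) \<in> V) \<and>
     (\<forall>(S, m)\<in>V. \<forall>(T, n)\<in>V. (prod_encode ` (S \<times> T), prod_sgp_mult m n) \<in> V)"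

definition Aplus :: "'a set \<Rightarrow> 'a list set" where
  "Aplus A = {w. w \<noteq> [] \<and> set w \<subseteq> A}"

text \<open>Congruences on A^+ whose quotient belongs to V (i.e. kernels of onto morphisms
from A^+ onto members of V); these index the A-generated members of V.\<close>
definition V_kernel :: "(nat set \<times> (nat \<Rightarrow> nat \<Rightarrow> nat)) set \<Rightarrow> 'a set \<Rightarrow> ('a list \<times> 'a list) set \<Rightarrow> bool" where
  "V_kernel V A \<theta> \<longleftrightarrow> (\<exists>S m h. (S, m) \<in> V \<and> h ` Aplus A = S \<and>
       (\<forall>u\<in>Aplus A. \<forall>v\<in>Aplus A. h (u @ v) = m (h u) (h v)) \<and>
       \<theta> = {(u, v). u \<in> Aplus A \<and> v \<in> Aplus A \<and> h u = h v})"

text \<open>The free pro-V semigroup over A, as the projective limit of the A-generated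
members of V: compatible families of classes.\<close>
definition FV :: "(nat set \<times> (nat \<Rightarrow> nat \<Rightarrow> nat)) set \<Rightarrow> 'a set \<Rightarrow> (('a list \<times> 'a list) set \<Rightarrow> 'a list set) set" where
  "FV V A = {x. (\<forall>\<theta>. V_kernel V A \<theta> \<longrightarrow> x \<theta> \<in> Aplus A // \<theta>) \<and>
     (\<forall>\<theta> \<theta>'. V_kernel V A \<theta> \<and> V_kernel V A \<theta>' \<and> \<theta> \<subseteq> \<theta>' \<longrightarrow> x \<theta> \<subseteq> x \<theta>') \<and>
     (\<forall>\<theta>. \<not> V_kernel V A \<theta> \<longrightarrow> x \<theta> = {})}"

definition FVmult :: "(nat set \<times> (nat \<Rightarrow> nat \<Rightarrow> nat)) set \<Rightarrow> 'a set \<Rightarrow>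
    (('a list \<times> 'a list) set \<Rightarrow> 'a list set) \<Rightarrow> (('a list \<times> 'a list) set \<Rightarrow> 'a list set) \<Rightarrow>
    (('a list \<times> 'a list) set \<Rightarrow> 'a list set)" where
  "FVmult V A x y = (\<lambda>\<theta>. if V_kernel V A \<theta>
      then \<theta> `` {(SOME u. u \<in> x \<theta>) @ (SOME v. v \<in> y \<theta>)} else {})"

definition mult1 :: "('b \<Rightarrow> 'b \<Rightarrow> 'b) \<Rightarrow> 'b option \<Rightarrow> 'b option \<Rightarrow> 'b option" where
  "mult1 f a b = (case a of None \<Rightarrow> b | Some a' \<Rightarrow> (case b of None \<Rightarrow> a | Some b' \<Rightarrow> Some (f a' b')))"

definition S1 :: "'b set \<Rightarrow> 'b option set" where
  "S1 C = insert None (Some ` C)"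

definition equidivisible :: "'b set \<Rightarrow> ('b \<Rightarrow> 'b \<Rightarrow> 'b) \<Rightarrow> bool" where
  "equidivisible C f \<longleftrightarrow> (\<forall>u\<in>C. \<forall>v\<in>C. \<forall>x\<in>C. \<forall>y\<in>C. f u v = f x y \<longrightarrow>
     (\<exists>t\<in>S1 C. (mult1 f (Some u) t = Some x \<and> Some v = mult1 f t (Some y)) \<or>
                (mult1 f (Some x) t = Some u \<and> Some y = mult1 f t (Some v))))"

definition equidivisible_pv :: "(nat set \<times> (nat \<Rightarrow> nat \<Rightarrow> nat)) set \<Rightarrow> bool" where
  "equidivisible_pv V \<longleftrightarrow> (\<forall>B :: nat set. finite B \<and> B \<noteq> {} \<longrightarrow> equidivisible (FV V B) (FVmult V B))"

definition Stab :: "'b set \<Rightarrow> ('b \<Rightarrow> 'b \<Rightarrow> 'b) \<Rightarrow> 'b \<Rightarrow> 'b option set" where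
  "Stab C f x = {y \<in> S1 C. mult1 f (Some x) y = Some x}"

definition internal_L_chain :: "('b \<Rightarrow> 'b \<Rightarrow> 'b) \<Rightarrow> 'b option set \<Rightarrow> bool" where
  "internal_L_chain f T \<longleftrightarrow> (\<forall>y\<in>T. \<forall>z\<in>T.
     y \<in> (\<lambda>t. mult1 f t z) ` T \<union> {z} \<or> z \<in> (\<lambda>t. mult1 f t y) ` T \<union> {y})"

definition internally_regular :: "('b \<Rightarrow> 'b \<Rightarrow> 'b) \<Rightarrow> 'b option set \<Rightarrow> 'b option \<Rightarrow> bool" where
  "internally_regular f T y \<longleftrightarrow> y \<in> T \<and> (\<exists>t\<in>T. y = mult1 f (mult1 f y t) y)"

end

theory Submission
  imports Defs "HOL-Analysis.Function_Topology"
begin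

text \<open>Equidivisibility passes from finite to arbitrary alphabets by compactness, as every finite
  quotient of \<open>A\<^sup>+\<close> factors through a finite alphabet. Applied to \<open>xy = x = xz\<close> it yields \<open>t\<close> with
  \<open>xt = x\<close> and \<open>y = tz\<close> or \<open>z = ty\<close>, so \<open>Stab(x)\<close> is an \<open>\<L>\<close>-chain.

  If \<open>y = yty\<close> in \<open>Stab(x)\<close>, then equidivisibility for \<open>x(yt) = x(ty)\<close> gives \<open>y = cy\<^sup>2\<close> or
  \<open>y = y\<^sup>2c\<close>, hence \<open>y\<close> is a group element in each finite quotient; over a finite alphabet we show
  there that \<open>y = y\<^sup>2\<close>. If \<open>y = kx\<close> in the quotient, then \<open>y\<^sup>2 = kxy = kx = y\<close>. Otherwise the
  two-element semilattice divides the quotient, which forces letters to be irreducible. Compactness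
  provides a factorization \<open>x\<^sup>2 = pas\<close> with \<open>a\<close> a letter such that, in the quotient, \<open>s\<close> is
  \<open>\<L>\<close>-above \<open>y\<close> but \<open>as\<close> is not. From \<open>pas = pasy\<close>, equidivisibility and irreducibility
  of \<open>a\<close> give \<open>s = sy\<close>; with \<open>y = ks\<close> in the quotient, \<open>y\<^sup>2 = ksy = ks = y\<close>.\<close>

section \<open>Finite quotients of free semigroups\<close>

lemma Aplus_append [simp]: "u \<in> Aplus A \<Longrightarrow> v \<in> Aplus A \<Longrightarrow> u @ v \<in> Aplus A"
  by (auto simp: Aplus_def)

lemma pseudovariety_fsgp: "pseudovariety V \<Longrightarrow> (S, m) \<in> V \<Longrightarrow> is_fsgp S m"
  unfolding pseudovariety_def by (elim conjE) fast

lemma pseudovariety_sub: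
  assumes "pseudovariety V" "(S, m) \<in> V" "T \<noteq> {}" "T \<subseteq> S" "\<And>a b. a \<in> T \<Longrightarrow> b \<in> T \<Longrightarrow> m a b \<in> T"
  shows "(T, m) \<in> V"
proof -
  have "\<forall>(S, m)\<in>V. \<forall>T. T \<noteq> {} \<and> T \<subseteq> S \<and> (\<forall>a\<in>T. \<forall>b\<in>T. m a b \<in> T) \<longrightarrow> (T, m) \<in> V"
    using assms(1) unfolding pseudovariety_def by (elim conjE)
  from bspec[OF this assms(2), unfolded prod.case, THEN spec, of T]
  show ?thesis using assms(3-) by simp
qed

lemma pseudovariety_image:
  assumes "pseudovariety V" "(S, m) \<in> V" "\<And>a b. a \<in> S \<Longrightarrow> b \<in> S \<Longrightarrow> h (m a b) = n (h a) (h b)"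
  shows "(h ` S, n) \<in> V"
proof -
  have "\<forall>(S, m)\<in>V. \<forall>T n h. h ` S = T \<and> (\<forall>a\<in>S. \<forall>b\<in>S. h (m a b) = n (h a) (h b)) \<longrightarrow> (T, n) \<in> V"
    using assms(1) unfolding pseudovariety_def by (elim conjE)
  from bspec[OF this assms(2), unfolded prod.case, THEN spec, THEN spec, THEN spec, of h "h ` S" n]
  show ?thesis using assms(3) by simp
qed

lemma pseudovariety_prod:
  assumes "pseudovariety V" "(S, m) \<in> V" "(T, n) \<in> V"
  shows "(prod_encode ` (S \<times> T), prod_sgp_mult m n) \<in> V"
proof -
  have "\<forall>(S, m)\<in>V. \<forall>(T, n)\<in>V. (prod_encode ` (S \<times> T), prod_sgp_mult m n) \<in> V"
    using assms(1) unfolding pseudovariety_def by (elim conjE)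
  with assms(2-) show ?thesis by blast
qed

lemma kernelE:
  assumes "V_kernel V A \<theta>"
  obtains S m h where "(S, m) \<in> V" "h ` Aplus A = S"
    "\<And>u v. u \<in> Aplus A \<Longrightarrow> v \<in> Aplus A \<Longrightarrow> h (u @ v) = m (h u) (h v)"
    "\<theta> = {(u, v). u \<in> Aplus A \<and> v \<in> Aplus A \<and> h u = h v}"
  using assms unfolding V_kernel_def by blast

text \<open>A morphism into a member of \<open>V\<close> suffices: its image is a subsemigroup,
  nonempty because there is a letter, hence again in \<open>V\<close>.\<close>

lemma kernelI:
  assumes "pseudovariety V" "(S, m) \<in> V" "A \<noteq> {}" "\<And>w. w \<in> Aplus A \<Longrightarrow> h w \<in> S"
    and hom: "\<And>u v. u \<in> Aplus A \<Longrightarrow> v \<in> Aplus A \<Longrightarrow> h (u @ v) = m (h u) (h v)"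
  shows "V_kernel V A {(u, v). u \<in> Aplus A \<and> v \<in> Aplus A \<and> h u = h v}"
proof -
  obtain a where "a \<in> A" using assms(3) by blast
  then have "[a] \<in> Aplus A" by (simp add: Aplus_def)
  then have ne: "h ` Aplus A \<noteq> {}" by blast
  have "m a b \<in> h ` Aplus A" if ab: "a \<in> h ` Aplus A" "b \<in> h ` Aplus A" for a b
  proof -
    from ab obtain u v where uv: "u \<in> Aplus A" "v \<in> Aplus A" "a = h u" "b = h v" by blast
    then have "m a b = h (u @ v)" using hom by simp
    with uv show ?thesis by simp
  qed
  moreover have "h ` Aplus A \<subseteq> S" using assms(4) by blast
  ultimately have "(h ` Aplus A, m) \<in> V"
    using pseudovariety_sub[OF assms(1,2) ne] by blast
  then show ?thesis unfolding V_kernel_def using hom by blast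
qed

lemma kernel_equiv: "V_kernel V A \<theta> \<Longrightarrow> equiv (Aplus A) \<theta>"
  by (erule kernelE) (auto intro!: equivI refl_onI symI transI)

lemma kernel_in_Aplus: "V_kernel V A \<theta> \<Longrightarrow> (u, v) \<in> \<theta> \<Longrightarrow> u \<in> Aplus A \<and> v \<in> Aplus A"
  by (erule kernelE) auto

lemma kernel_refl: "V_kernel V A \<theta> \<Longrightarrow> u \<in> Aplus A \<Longrightarrow> (u, u) \<in> \<theta>"
  by (erule kernelE) auto

lemma kernel_sym: "V_kernel V A \<theta> \<Longrightarrow> (u, v) \<in> \<theta> \<Longrightarrow> (v, u) \<in> \<theta>"
  by (erule kernelE) auto

lemma kernel_trans: "V_kernel V A \<theta> \<Longrightarrow> (u, v) \<in> \<theta> \<Longrightarrow> (v, w) \<in> \<theta> \<Longrightarrow> (u, w) \<in> \<theta>"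
  by (erule kernelE) auto

lemma kernel_append:
  "V_kernel V A \<theta> \<Longrightarrow> (u, u') \<in> \<theta> \<Longrightarrow> (v, v') \<in> \<theta> \<Longrightarrow> (u @ v, u' @ v') \<in> \<theta>"
  by (erule kernelE) auto

text \<open>The contexts are given by \<open>set p \<subseteq> A\<close>, that is, words of A^*, so
  that either side may be empty.\<close>

lemma kernel_context:
  assumes "V_kernel V A \<theta>" "(u, u') \<in> \<theta>" "set p \<subseteq> A" "set q \<subseteq> A"
  shows "(p @ u @ q, p @ u' @ q) \<in> \<theta>"
proof -
  have "(u @ q, u' @ q) \<in> \<theta>"
  proof (cases "q = []")
    case False
    then have "(q, q) \<in> \<theta>" using assms by (intro kernel_refl) (auto simp: Aplus_def)
    then show ?thesis using kernel_append[OF assms(1,2)] by blast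
  qed (use assms in auto)
  then show ?thesis
  proof (cases "p = []")
    case False
    then have "(p, p) \<in> \<theta>" using assms by (intro kernel_refl) (auto simp: Aplus_def)
    then show ?thesis using kernel_append[OF assms(1)] \<open>(u @ q, u' @ q) \<in> \<theta>\<close> by blast
  qed auto
qed

text \<open>The intersection is the kernel of the pair of morphisms into the direct product, coded
  on naturals by \<open>prod_encode\<close>. Kernels are thus directed downwards, the basis of every
  compactness argument below.\<close>

lemma kernel_Int:
  assumes pv: "pseudovariety V" and k1: "V_kernel V A \<theta>1" and k2: "V_kernel V A \<theta>2"
  shows "V_kernel V A (\<theta>1 \<inter> \<theta>2)"
proof -
  obtain S m h where 1: "(S, m) \<in> V" "h ` Aplus A = S"
    "\<And>u v. u \<in> Aplus A \<Longrightarrow> v \<in> Aplus A \<Longrightarrow> h (u @ v) = m (h u) (h v)"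
    "\<theta>1 = {(u, v). u \<in> Aplus A \<and> v \<in> Aplus A \<and> h u = h v}" by (rule kernelE[OF k1]) (rule that)
  obtain T n g where 2: "(T, n) \<in> V" "g ` Aplus A = T"
    "\<And>u v. u \<in> Aplus A \<Longrightarrow> v \<in> Aplus A \<Longrightarrow> g (u @ v) = n (g u) (g v)"
    "\<theta>2 = {(u, v). u \<in> Aplus A \<and> v \<in> Aplus A \<and> g u = g v}" by (rule kernelE[OF k2]) (rule that)
  have "A \<noteq> {}"
  proof
    assume "A = {}"
    then have "S = {}" using 1(2) by (auto simp: Aplus_def)
    then show False using pseudovariety_fsgp[OF pv 1(1)] by (simp add: is_fsgp_def)
  qed
  then have "V_kernel V A {(u, v). u \<in> Aplus A \<and> v \<in> Aplus A \<and>
      prod_encode (h u, g u) = prod_encode (h v, g v)}"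
  proof (rule kernelI[OF pv pseudovariety_prod[OF pv 1(1) 2(1)]])
    fix u assume "u \<in> Aplus A"
    then show "prod_encode (h u, g u) \<in> prod_encode ` (S \<times> T)" using 1(2) 2(2) by blast
  qed (use \<open>A \<noteq> {}\<close> in \<open>simp_all add: prod_sgp_mult_def 1(3) 2(3)\<close>)
  also have "{(u, v). u \<in> Aplus A \<and> v \<in> Aplus A \<and>
      prod_encode (h u, g u) = prod_encode (h v, g v)} = \<theta>1 \<inter> \<theta>2"
    using 1(4) 2(4) by auto
  finally show ?thesis .
qed

lemma kernel_Inter:
  assumes "pseudovariety V" "finite F" "F \<noteq> {}" "\<And>\<theta>. \<theta> \<in> F \<Longrightarrow> V_kernel V A \<theta>"
  shows "V_kernel V A (\<Inter>F)"
  using assms(2-4)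
proof (induction F rule: finite_ne_induct)
  case (insert \<theta> F)
  then show ?case using kernel_Int[OF assms(1), of A \<theta> "\<Inter>F"] by simp
qed simp

lemma finite_kernel_quotient:
  assumes pv: "pseudovariety V" and k: "V_kernel V A \<theta>"
  shows "finite (Aplus A // \<theta>)"
proof -
  obtain S m h where 1: "(S, m) \<in> V" "h ` Aplus A = S"
    "\<theta> = {(u, v). u \<in> Aplus A \<and> v \<in> Aplus A \<and> h u = h v}" by (rule kernelE[OF k]) (rule that)
  \<comment> \<open>The classes are the fibres of \<open>h\<close>, indexed by the finite set
    \<open>S\<close>.\<close>
  have "Aplus A // \<theta> \<subseteq> (\<lambda>s. {v \<in> Aplus A. h v = s}) ` S"
  proof
    fix c assume "c \<in> Aplus A // \<theta>"
    then obtain u where u: "u \<in> Aplus A" "c = \<theta> `` {u}" by (auto elim: quotientE)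
    then have "c = {v \<in> Aplus A. h v = h u}" using 1(3) by auto
    then show "c \<in> (\<lambda>s. {v \<in> Aplus A. h v = s}) ` S" using 1(2) u by blast
  qed
  moreover have "finite S" using pseudovariety_fsgp[OF pv 1(1)] by (simp add: is_fsgp_def)
  ultimately show ?thesis by (meson finite_imageI finite_subset)
qed

section \<open>The free pro-\<open>V\<close> semigroup\<close>

lemma FV_nonempty:
  assumes "x \<in> FV V A" "V_kernel V A \<theta>"
  obtains w where "w \<in> x \<theta>" "w \<in> Aplus A"
proof -
  have "x \<theta> \<in> Aplus A // \<theta>" using assms by (simp add: FV_def)
  then obtain w where "w \<in> Aplus A" "x \<theta> = \<theta> `` {w}" by (auto elim: quotientE)
  then show ?thesis using that kernel_refl[OF assms(2)] by blast
qed

lemma FV_in_Aplus: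
  assumes "x \<in> FV V A" "w \<in> x \<theta>" shows "w \<in> Aplus A"
proof (cases "V_kernel V A \<theta>")
  case True
  then have "x \<theta> \<in> Aplus A // \<theta>" using assms by (simp add: FV_def)
  then show ?thesis using assms(2) kernel_in_Aplus[OF True] by (auto elim!: quotientE)
qed (use assms in \<open>auto simp: FV_def\<close>)

lemma FV_class:
  assumes "x \<in> FV V A" "V_kernel V A \<theta>" "w \<in> x \<theta>" shows "x \<theta> = \<theta> `` {w}"
proof -
  have "x \<theta> \<in> Aplus A // \<theta>" using assms by (simp add: FV_def)
  then obtain u where u: "u \<in> Aplus A" "x \<theta> = \<theta> `` {u}" by (auto elim: quotientE)
  with assms(3) have "(u, w) \<in> \<theta>" by auto
  then show ?thesis using u equiv_class_eq[OF kernel_equiv[OF assms(2)]] by simp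
qed

lemma FV_mono:
  "x \<in> FV V A \<Longrightarrow> V_kernel V A \<theta> \<Longrightarrow> V_kernel V A \<theta>' \<Longrightarrow> \<theta> \<subseteq> \<theta>' \<Longrightarrow> w \<in> x \<theta> \<Longrightarrow> w \<in> x \<theta>'"
  unfolding FV_def by blast

lemma FV_rel:
  "x \<in> FV V A \<Longrightarrow> V_kernel V A \<theta> \<Longrightarrow> w \<in> x \<theta> \<Longrightarrow> w' \<in> x \<theta> \<Longrightarrow> (w, w') \<in> \<theta>"
  using FV_class by fast

lemma FV_closed:
  "x \<in> FV V A \<Longrightarrow> V_kernel V A \<theta> \<Longrightarrow> w \<in> x \<theta> \<Longrightarrow> (w, w') \<in> \<theta> \<Longrightarrow> w' \<in> x \<theta>"
  using FV_class by fast

text \<open>If a class of a finer congruence meets a class of a coarser one, it is contained in it;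
  so one common word per pair of kernels proves compatibility.\<close>

lemma FV_I:
  assumes cls: "\<And>\<theta>. V_kernel V A \<theta> \<Longrightarrow> \<exists>w\<in>Aplus A. x \<theta> = \<theta> `` {w}"
    and cons: "\<And>\<theta> \<theta>'. V_kernel V A \<theta> \<Longrightarrow> V_kernel V A \<theta>' \<Longrightarrow> \<theta> \<subseteq> \<theta>' \<Longrightarrow> \<exists>w. w \<in> x \<theta> \<and> w \<in> x \<theta>'"
    and "\<And>\<theta>. \<not> V_kernel V A \<theta> \<Longrightarrow> x \<theta> = {}"
  shows "x \<in> FV V A"
proof -
  have "x \<theta> \<subseteq> x \<theta>'" if k: "V_kernel V A \<theta>" "V_kernel V A \<theta>'" "\<theta> \<subseteq> \<theta>'" for \<theta> \<theta>'
  proof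
    fix v assume v: "v \<in> x \<theta>"
    obtain w where w: "w \<in> x \<theta>" "w \<in> x \<theta>'" using cons[OF k] by blast
    have "(w, v) \<in> \<theta>" using cls[OF k(1)] v w(1) kernel_trans[OF k(1)] kernel_sym[OF k(1)] by blast
    then have "(w, v) \<in> \<theta>'" using k by blast
    then show "v \<in> x \<theta>'" using cls[OF k(2)] w(2) kernel_trans[OF k(2)] by blast
  qed
  moreover have "x \<theta> \<in> Aplus A // \<theta>" if "V_kernel V A \<theta>" for \<theta>
    using cls[OF that] by (auto intro: quotientI)
  ultimately show ?thesis using assms(3) by (simp add: FV_def)
qed

text \<open>Two classes that meet are equal, and off the kernels both families take the default
  value \<open>{}\<close>.\<close>

lemma FV_eqI:
  assumes "x \<in> FV V A" "y \<in> FV V A" "\<And>\<theta>. V_kernel V A \<theta> \<Longrightarrow> \<exists>w. w \<in> x \<theta> \<and> w \<in> y \<theta>"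
  shows "x = y"
proof
  fix \<theta>
  show "x \<theta> = y \<theta>"
  proof (cases "V_kernel V A \<theta>")
    case True
    then show ?thesis using assms FV_class by metis
  qed (use assms in \<open>auto simp: FV_def\<close>)
qed

text \<open>Removes the choice operator from \<open>FVmult\<close>: kernels are congruences, so
  arbitrary representatives may be concatenated.\<close>

lemma FVmult_mem:
  assumes "x \<in> FV V A" "y \<in> FV V A" "V_kernel V A \<theta>" "u \<in> x \<theta>" "v \<in> y \<theta>"
  shows "u @ v \<in> FVmult V A x y \<theta>"
proof -
  have "((SOME u. u \<in> x \<theta>), u) \<in> \<theta>" using assms FV_rel by (metis someI)
  moreover have "((SOME v. v \<in> y \<theta>), v) \<in> \<theta>" using assms FV_rel by (metis someI)
  ultimately show ?thesis using kernel_append[OF assms(3)] assms(3) by (simp add: FVmult_def)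
qed

lemma FVmult_closed [simp]:
  assumes "x \<in> FV V A" "y \<in> FV V A" shows "FVmult V A x y \<in> FV V A"
proof (rule FV_I)
  fix \<theta> assume k: "V_kernel V A \<theta>"
  have "(SOME u. u \<in> x \<theta>) \<in> x \<theta>" using FV_nonempty[OF assms(1) k] by (metis someI)
  moreover have "(SOME v. v \<in> y \<theta>) \<in> y \<theta>" using FV_nonempty[OF assms(2) k] by (metis someI)
  ultimately have "(SOME u. u \<in> x \<theta>) @ (SOME v. v \<in> y \<theta>) \<in> Aplus A"
    using assms FV_in_Aplus Aplus_append by metis
  then show "\<exists>w\<in>Aplus A. FVmult V A x y \<theta> = \<theta> `` {w}" using k by (auto simp: FVmult_def)
next
  fix \<theta> \<theta>' assume k: "V_kernel V A \<theta>" "V_kernel V A \<theta>'" "\<theta> \<subseteq> \<theta>'"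
  obtain u where u: "u \<in> x \<theta>" using FV_nonempty[OF assms(1) k(1)] .
  obtain v where v: "v \<in> y \<theta>" using FV_nonempty[OF assms(2) k(1)] .
  have "u \<in> x \<theta>'" "v \<in> y \<theta>'" using FV_mono k u v assms by metis+
  with u v show "\<exists>w. w \<in> FVmult V A x y \<theta> \<and> w \<in> FVmult V A x y \<theta>'"
    using FVmult_mem[OF assms k(1)] FVmult_mem[OF assms k(2)] by blast
qed (simp add: FVmult_def)

lemma FVmult_assoc:
  assumes "x \<in> FV V A" "y \<in> FV V A" "z \<in> FV V A"
  shows "FVmult V A (FVmult V A x y) z = FVmult V A x (FVmult V A y z)"
proof (rule FV_eqI)
  fix \<theta> assume k: "V_kernel V A \<theta>"
  obtain u where u: "u \<in> x \<theta>" using FV_nonempty[OF assms(1) k] .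
  obtain v where v: "v \<in> y \<theta>" using FV_nonempty[OF assms(2) k] .
  obtain w where w: "w \<in> z \<theta>" using FV_nonempty[OF assms(3) k] .
  have "(u @ v) @ w \<in> FVmult V A (FVmult V A x y) z \<theta>" "u @ v @ w \<in> FVmult V A x (FVmult V A y z) \<theta>"
    using assms k u v w by (auto intro!: FVmult_mem simp del: append_assoc)
  then show "\<exists>w. w \<in> FVmult V A (FVmult V A x y) z \<theta> \<and> w \<in> FVmult V A x (FVmult V A y z) \<theta>"
    by auto
qed (use assms in auto)

section \<open>Words as elements of the limit, and compactness\<close>

definition FVword :: "(nat set \<times> (nat \<Rightarrow> nat \<Rightarrow> nat)) set \<Rightarrow> 'a set \<Rightarrow> 'a list \<Rightarrow>
    ('a list \<times> 'a list) set \<Rightarrow> 'a list set" where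
  "FVword V A w = (\<lambda>\<theta>. if V_kernel V A \<theta> then \<theta> `` {w} else {})"

lemma FVword_mem: "V_kernel V A \<theta> \<Longrightarrow> w \<in> Aplus A \<Longrightarrow> w \<in> FVword V A w \<theta>"
  by (auto simp: FVword_def intro: kernel_refl)

lemma FVword_closed [simp]: "w \<in> Aplus A \<Longrightarrow> FVword V A w \<in> FV V A"
proof (rule FV_I)
  fix \<theta> \<theta>' assume "w \<in> Aplus A" "V_kernel V A \<theta>" "V_kernel V A \<theta>'"
  then show "\<exists>v. v \<in> FVword V A w \<theta> \<and> v \<in> FVword V A w \<theta>'" using FVword_mem by metis
qed (auto simp: FVword_def)

text \<open>Compactness of the projective limit, by Tychonoff's theorem for the product of the finite
  discrete quotients.\<close>

lemma FV_compact:
  assumes pv: "pseudovariety V"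
    and ex: "\<And>\<theta>. V_kernel V A \<theta> \<Longrightarrow> \<exists>w\<in>Aplus A. Q \<theta> w"
    and anti: "\<And>\<theta> \<theta>' w. V_kernel V A \<theta> \<Longrightarrow> V_kernel V A \<theta>' \<Longrightarrow> \<theta> \<subseteq> \<theta>' \<Longrightarrow> Q \<theta> w \<Longrightarrow> Q \<theta>' w"
  shows "\<exists>t\<in>FV V A. \<forall>\<theta>. V_kernel V A \<theta> \<longrightarrow> (\<exists>w\<in>t \<theta>. Q \<theta> w)"
proof -
  define K where "K = Collect (V_kernel V A)"
  define X where "X = product_topology (\<lambda>\<theta>. discrete_topology (Aplus A // \<theta>)) K"
  have top: "topspace X = Pi\<^sub>E K (\<lambda>\<theta>. Aplus A // \<theta>)" by (simp add: X_def)
  have comp: "compact_space X"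
    unfolding X_def compact_space_product_topology compact_space_discrete_topology
    using finite_kernel_quotient[OF pv] by (auto simp: K_def)
  \<comment> \<open>Each factor is discrete, so any condition on a single coordinate is
    closed.\<close>
  have clopen: "closedin X {t \<in> topspace X. P (t \<theta>)}" if "\<theta> \<in> K" for \<theta> and P :: "'a list set \<Rightarrow> bool"
  proof -
    have "continuous_map X (discrete_topology (Aplus A // \<theta>)) (\<lambda>t. t \<theta>)"
      unfolding X_def by (rule continuous_map_product_projection[OF that])
    from closedin_continuous_map_preimage[OF this, of "{c \<in> Aplus A // \<theta>. P c}"]
    have "closedin X {t \<in> topspace X. t \<theta> \<in> {c \<in> Aplus A // \<theta>. P c}}" by simp
    moreover have "{t \<in> topspace X. t \<theta> \<in> {c \<in> Aplus A // \<theta>. P c}} = {t \<in> topspace X. P (t \<theta>)}"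
      using that by (auto simp: top)
    ultimately show ?thesis by simp
  qed
  \<comment> \<open>A condition on two coordinates is split over the finitely many values
    \<open>c\<close> of the first one, which leaves conditions on single coordinates.\<close>
  have le: "closedin X {t \<in> topspace X. t \<theta> \<subseteq> t \<theta>'}" if "\<theta> \<in> K" "\<theta>' \<in> K" for \<theta> \<theta>'
  proof -
    have "{t \<in> topspace X. t \<theta> \<subseteq> t \<theta>'} =
        (\<Union>c\<in>Aplus A // \<theta>. {t \<in> topspace X. t \<theta> = c} \<inter> {t \<in> topspace X. c \<subseteq> t \<theta>'})"
      using that by (auto simp: top)
    also have "closedin X \<dots>"
      using finite_kernel_quotient[OF pv] that by (intro closedin_Union) (auto simp: K_def intro!: clopen[unfolded K_def])
    finally show ?thesis .
  qed
  \<comment> \<open>\<open>C \<theta>\<close> joins the demand for a witness of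
    \<open>Q \<theta>\<close> to compatibility with all kernels above \<open>\<theta>\<close>; a
    point in every \<open>C \<theta>\<close> is the required element.\<close>
  define C where "C \<theta> = {t \<in> topspace X. \<exists>w\<in>t \<theta>. Q \<theta> w} \<inter>
    (\<Inter>\<theta>'\<in>{\<theta>' \<in> K. \<theta> \<subseteq> \<theta>'}. {t \<in> topspace X. t \<theta> \<subseteq> t \<theta>'})" for \<theta>
  have closed: "closedin X (C \<theta>)" if "\<theta> \<in> K" for \<theta>
    unfolding C_def using that by (intro closedin_Int closedin_INT clopen le) auto
  have fip: "\<Inter>(C ` F) \<noteq> {}" if F: "finite F" "F \<subseteq> K" for F
  proof (cases "F = {}")
    case False
    \<comment> \<open>One word \<open>w\<close> with \<open>Q\<close> at the intersection serves all
      of \<open>F\<close>: its classes form a compatible family, and \<open>anti\<close> carries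
      \<open>Q\<close> up to each \<open>\<theta> \<in> F\<close>.\<close>
    have k: "V_kernel V A (\<Inter>F)" using kernel_Inter[OF pv F(1) False] F(2) by (auto simp: K_def)
    obtain w where w: "w \<in> Aplus A" "Q (\<Inter>F) w" using ex[OF k] by blast
    define t where "t = (\<lambda>\<theta>\<in>K. \<theta> `` {w})"
    have "t \<in> topspace X" using w by (auto simp: top t_def intro: quotientI)
    moreover have "w \<in> t \<theta>" "Q \<theta> w" if "\<theta> \<in> F" for \<theta>
    proof -
      have "V_kernel V A \<theta>" using that F by (auto simp: K_def)
      then show "w \<in> t \<theta>" "Q \<theta> w"
        using that w anti[OF k] by (auto simp: K_def t_def intro: kernel_refl)
    qed
    moreover have "t \<theta> \<subseteq> t \<theta>'" if "\<theta> \<in> K" "\<theta>' \<in> K" "\<theta> \<subseteq> \<theta>'" for \<theta> \<theta>'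
      using that by (auto simp: t_def)
    ultimately have "t \<in> C \<theta>" if "\<theta> \<in> F" for \<theta>
      using that F unfolding C_def by blast
    then show ?thesis by blast
  qed simp
  have "\<Inter>(C ` K) \<noteq> {}"
  proof (rule compact_space_fip[THEN iffD1, rule_format, OF comp], intro conjI ballI allI impI)
    fix \<F> assume "finite \<F> \<and> \<F> \<subseteq> C ` K"
    then obtain F where "finite F" "F \<subseteq> K" "\<F> = C ` F" by (metis finite_subset_image)
    then show "\<Inter>\<F> \<noteq> {}" using fip by blast
  qed (use closed in blast)
  then obtain t where tC: "\<And>\<theta>. \<theta> \<in> K \<Longrightarrow> t \<in> C \<theta>" by blast
  have t: "t \<theta> \<in> Aplus A // \<theta>" "\<exists>w\<in>t \<theta>. Q \<theta> w" if "\<theta> \<in> K" for \<theta>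
    using tC[OF that] that by (auto simp: C_def top)
  have mono: "t \<theta> \<subseteq> t \<theta>'" if "\<theta> \<in> K" "\<theta>' \<in> K" "\<theta> \<subseteq> \<theta>'" for \<theta> \<theta>'
    using tC[OF that(1)] that unfolding C_def by blast
  \<comment> \<open>Points of the product are \<open>undefined\<close> outside \<open>K\<close>,
    whereas \<open>FV\<close> demands the value \<open>{}\<close> there.\<close>
  define t' where "t' = (\<lambda>\<theta>. if \<theta> \<in> K then t \<theta> else {})"
  have "t' \<in> FV V A" using t(1) mono by (simp add: FV_def t'_def K_def)
  then show ?thesis using t(2) by (intro bexI[of _ t']) (auto simp: t'_def K_def)
qed

section \<open>Substitutions\<close>

locale FV_substitution =
  fixes V :: "(nat set \<times> (nat \<Rightarrow> nat \<Rightarrow> nat)) set"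
    and A :: "'a set" and B :: "'b set" and \<sigma> :: "'a \<Rightarrow> 'b list"
  assumes pv: "pseudovariety V" and ne: "A \<noteq> {}" and letter: "a \<in> A \<Longrightarrow> \<sigma> a \<in> Aplus B"
begin

abbreviation subst :: "'a list \<Rightarrow> 'b list" where "subst w \<equiv> concat (map \<sigma> w)"

definition pull :: "('b list \<times> 'b list) set \<Rightarrow> ('a list \<times> 'a list) set" where
  "pull \<eta> = {(u, v). u \<in> Aplus A \<and> v \<in> Aplus A \<and> (subst u, subst v) \<in> \<eta>}"

text \<open>The homomorphism from \<open>FV V A\<close> to \<open>FV V B\<close> that extends
  \<open>\<sigma>\<close>. Words of one class modulo \<open>pull \<eta>\<close> have images in one
  class modulo \<open>\<eta>\<close>; the relational image under \<open>\<eta>\<close> fills up that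
  class.\<close>

definition push :: "(('a list \<times> 'a list) set \<Rightarrow> 'a list set) \<Rightarrow> ('b list \<times> 'b list) set \<Rightarrow> 'b list set" where
  "push x \<eta> = (if V_kernel V B \<eta> then \<eta> `` (subst ` x (pull \<eta>)) else {})"

lemma subst_in_Aplus:
  assumes "w \<in> Aplus A" shows "subst w \<in> Aplus B"
proof (cases w)
  case (Cons a v)
  then have "a \<in> A" "set w \<subseteq> A" using assms by (auto simp: Aplus_def)
  moreover have "set (\<sigma> b) \<subseteq> B" if "b \<in> A" for b using letter[OF that] by (simp add: Aplus_def)
  ultimately show ?thesis using letter[of a] Cons by (auto simp: Aplus_def)
qed (use assms in \<open>simp add: Aplus_def\<close>)

text \<open>If \<open>\<eta>\<close> is the kernel of \<open>h\<close>, then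
  \<open>pull \<eta>\<close> is the kernel of \<open>h\<close> composed with the
  substitution.\<close>

lemma pull_kernel:
  assumes "V_kernel V B \<eta>" shows "V_kernel V A (pull \<eta>)"
proof -
  obtain S m h where h: "(S, m) \<in> V" "h ` Aplus B = S"
    "\<And>u v. u \<in> Aplus B \<Longrightarrow> v \<in> Aplus B \<Longrightarrow> h (u @ v) = m (h u) (h v)"
    "\<eta> = {(u, v). u \<in> Aplus B \<and> v \<in> Aplus B \<and> h u = h v}" by (rule kernelE[OF assms]) (rule that)
  have "V_kernel V A {(u, v). u \<in> Aplus A \<and> v \<in> Aplus A \<and> h (subst u) = h (subst v)}"
  proof (rule kernelI[OF pv h(1) ne])
    fix w assume "w \<in> Aplus A"
    then show "h (subst w) \<in> S" using h(2) subst_in_Aplus by blast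
  qed (simp add: h(3) subst_in_Aplus)
  also have "{(u, v). u \<in> Aplus A \<and> v \<in> Aplus A \<and> h (subst u) = h (subst v)} = pull \<eta>"
    unfolding pull_def h(4) using subst_in_Aplus by blast
  finally show ?thesis .
qed

lemma push_mem:
  assumes "x \<in> FV V A" "V_kernel V B \<eta>" "w \<in> x (pull \<eta>)" shows "subst w \<in> push x \<eta>"
proof -
  have "(subst w, subst w) \<in> \<eta>"
    using kernel_refl[OF assms(2)] subst_in_Aplus FV_in_Aplus[OF assms(1,3)] by blast
  then show ?thesis using assms by (auto simp: push_def)
qed

lemma push_closed [simp]:
  assumes x: "x \<in> FV V A" shows "push x \<in> FV V B"
proof (rule FV_I)
  fix \<eta> assume k: "V_kernel V B \<eta>"
  obtain w where w: "w \<in> x (pull \<eta>)" "w \<in> Aplus A" using FV_nonempty[OF x pull_kernel[OF k]] .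
  have "\<eta> `` (subst ` x (pull \<eta>)) = \<eta> `` {subst w}"
  proof
    show "\<eta> `` (subst ` x (pull \<eta>)) \<subseteq> \<eta> `` {subst w}"
    proof
      fix v assume "v \<in> \<eta> `` (subst ` x (pull \<eta>))"
      then obtain u where u: "u \<in> x (pull \<eta>)" "(subst u, v) \<in> \<eta>" by blast
      have "(w, u) \<in> pull \<eta>" using FV_rel[OF x pull_kernel[OF k] w(1) u(1)] .
      then have "(subst w, subst u) \<in> \<eta>" by (simp add: pull_def)
      then show "v \<in> \<eta> `` {subst w}" using kernel_trans[OF k] u(2) by blast
    qed
  qed (use w in auto)
  then show "\<exists>w\<in>Aplus B. push x \<eta> = \<eta> `` {w}"
    using k subst_in_Aplus[OF w(2)] by (auto simp: push_def)
next
  fix \<eta> \<eta>' assume k: "V_kernel V B \<eta>" "V_kernel V B \<eta>'" "\<eta> \<subseteq> \<eta>'"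
  obtain w where w: "w \<in> x (pull \<eta>)" using FV_nonempty[OF x pull_kernel[OF k(1)]] .
  have "pull \<eta> \<subseteq> pull \<eta>'" using k(3) by (auto simp: pull_def)
  then have "w \<in> x (pull \<eta>')" using FV_mono[OF x pull_kernel[OF k(1)] pull_kernel[OF k(2)]] w by blast
  with w show "\<exists>w. w \<in> push x \<eta> \<and> w \<in> push x \<eta>'"
    using push_mem[OF x k(1)] push_mem[OF x k(2)] by blast
qed (simp add: push_def)

lemma push_mult:
  assumes x: "x \<in> FV V A" and y: "y \<in> FV V A"
  shows "push (FVmult V A x y) = FVmult V B (push x) (push y)"
proof (rule FV_eqI)
  fix \<eta> assume k: "V_kernel V B \<eta>"
  obtain u where u: "u \<in> x (pull \<eta>)" using FV_nonempty[OF x pull_kernel[OF k]] .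
  obtain v where v: "v \<in> y (pull \<eta>)" using FV_nonempty[OF y pull_kernel[OF k]] .
  have "subst (u @ v) \<in> push (FVmult V A x y) \<eta>"
    by (rule push_mem[OF FVmult_closed[OF x y] k]) (intro FVmult_mem x y u v pull_kernel k)
  moreover have "subst u @ subst v \<in> FVmult V B (push x) (push y) \<eta>"
    by (intro FVmult_mem push_mem push_closed x y k u v)
  ultimately show "\<exists>w. w \<in> push (FVmult V A x y) \<eta> \<and> w \<in> FVmult V B (push x) (push y) \<eta>"
    by auto
qed (use x y in auto)

text \<open>Brings equations over \<open>B\<close> back to \<open>A\<close>: equality of the images
  determines the coordinate at \<open>pull \<eta>\<close>.\<close>

lemma push_eq_at:
  assumes k: "V_kernel V B \<eta>" and x: "x \<in> FV V A" and y: "y \<in> FV V A" and eq: "push x = push y"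
    and u: "u \<in> x (pull \<eta>)" and v: "v \<in> y (pull \<eta>)"
  shows "(u, v) \<in> pull \<eta>"
proof -
  have "(subst u, subst v) \<in> \<eta>"
    using FV_rel[OF push_closed[OF x] k] push_mem[OF x k u] push_mem[OF y k v] eq by metis
  then show ?thesis using FV_in_Aplus x y u v by (auto simp: pull_def)
qed

end

text \<open>A kernel of \<open>h : A\<^sup>+ \<rightarrow> S\<close> is pulled back from the finite alphabet of the values of \<open>h\<close> on letters.\<close>

lemma kernel_from_finite_alphabet:
  assumes pv: "pseudovariety V" and k: "V_kernel V A \<theta>"
  obtains B :: "nat set" and \<sigma> \<eta> where "finite B" "B \<noteq> {}" "FV_substitution V A B \<sigma>"
    "V_kernel V B \<eta>" "FV_substitution.pull A \<sigma> \<eta> = \<theta>"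
    "\<And>w. w \<in> Aplus B \<Longrightarrow> \<exists>v\<in>Aplus A. concat (map \<sigma> v) = w"
proof -
  obtain S m h where h: "(S, m) \<in> V" "h ` Aplus A = S"
    "\<And>u v. u \<in> Aplus A \<Longrightarrow> v \<in> Aplus A \<Longrightarrow> h (u @ v) = m (h u) (h v)"
    "\<theta> = {(u, v). u \<in> Aplus A \<and> v \<in> Aplus A \<and> h u = h v}" by (rule kernelE[OF k]) (rule that)
  have S: "finite S" "S \<noteq> {}" using pseudovariety_fsgp[OF pv h(1)] by (auto simp: is_fsgp_def)
  have ne: "A \<noteq> {}" using S(2) h(2) by (auto simp: Aplus_def)
  define f where "f a = h [a]" for a
  define B where "B = f ` A"
  \<comment> \<open>\<open>r\<close> chooses a letter of \<open>A\<close> with the given value under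
    \<open>h\<close>; since \<open>f (r b) = b\<close>, the substitution is onto.\<close>
  define r where "r = inv_into A f"
  define \<sigma> where "\<sigma> a = [f a]" for a
  have subst: "concat (map \<sigma> w) = map f w" for w by (induction w) (auto simp: \<sigma>_def)
  have fr: "f (r b) = b" "r b \<in> A" if "b \<in> B" for b
    using that unfolding r_def B_def by (auto intro: f_inv_into_f inv_into_into)
  have r_Aplus: "map r w \<in> Aplus A" if "w \<in> Aplus B" for w
    using that fr by (auto simp: Aplus_def)
  have "B \<subseteq> S" using h(2) by (auto simp: B_def f_def Aplus_def)
  have fin: "finite B" by (rule finite_subset[OF \<open>B \<subseteq> S\<close> S(1)])
  have B: "B \<noteq> {}" using ne by (simp add: B_def)
  interpret FV_substitution V A B \<sigma>
    by unfold_locales (use pv ne in \<open>auto simp: \<sigma>_def Aplus_def B_def\<close>)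
  \<comment> \<open>As the letters in \<open>B\<close> are elements of \<open>S\<close>, this is the
    kernel of evaluating words over \<open>B\<close> in \<open>S\<close>.\<close>
  define \<eta> where "\<eta> = {(u, v). u \<in> Aplus B \<and> v \<in> Aplus B \<and> h (map r u) = h (map r v)}"
  have \<eta>: "V_kernel V B \<eta>" unfolding \<eta>_def
  proof (rule kernelI[OF pv h(1) B])
    fix w assume "w \<in> Aplus B"
    then show "h (map r w) \<in> S" using r_Aplus h(2) by blast
  qed (simp add: h(3) r_Aplus)
  \<comment> \<open>Exchanging each letter for the chosen one of equal value leaves the product in
    \<open>S\<close> unchanged.\<close>
  have rf: "h (map r (map f w)) = h w" if "w \<in> Aplus A" for w
    using that
  proof (induction w)
    case (Cons a w)
    then have a: "a \<in> A" "f a \<in> B" by (auto simp: Aplus_def B_def)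
    have 1: "h [r (f a)] = h [a]" using fr(1)[OF a(2)] by (simp add: f_def)
    show ?case
    proof (cases "w = []")
      case False
      then have w: "w \<in> Aplus A" using Cons.prems by (simp add: Aplus_def)
      then have w': "map r (map f w) \<in> Aplus A" using fr by (auto simp: Aplus_def B_def)
      have "h (map r (map f (a # w))) = h ([r (f a)] @ map r (map f w))" by simp
      also have "\<dots> = m (h [r (f a)]) (h (map r (map f w)))"
        using fr(2)[OF a(2)] by (intro h(3) w') (simp add: Aplus_def)
      also have "\<dots> = h ([a] @ w)" unfolding 1 Cons.IH[OF w]
        using a w by (intro h(3)[symmetric]) (auto simp: Aplus_def)
      finally show ?thesis by simp
    qed (use 1 in simp)
  qed (simp add: Aplus_def)
  have "pull \<eta> = \<theta>"
  proof -
    have "map f w \<in> Aplus B" if "w \<in> Aplus A" for w using that by (auto simp: Aplus_def B_def)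
    then show ?thesis unfolding pull_def h(4) \<eta>_def subst using rf by auto
  qed
  moreover have "\<exists>v\<in>Aplus A. concat (map \<sigma> v) = w" if "w \<in> Aplus B" for w
  proof
    have "map f (map r w) = w" using that fr(1) by (auto simp: Aplus_def intro!: map_idI)
    then show "concat (map \<sigma> (map r w)) = w" by (simp only: subst)
  qed (rule r_Aplus[OF that])
  ultimately show ?thesis using that fin B \<eta> FV_substitution_axioms by blast
qed

section \<open>Equidivisibility over arbitrary alphabets\<close>

text \<open>If each of the finitely many \<open>i\<close> failed at some kernel, then all would fail
  at the intersection of these kernels, because failure passes to finer kernels.\<close>

lemma FV_pigeonhole:
  assumes pv: "pseudovariety V" and I: "finite I" "I \<noteq> {}"
    and ex: "\<And>\<theta>. V_kernel V A \<theta> \<Longrightarrow> \<exists>i\<in>I. D i \<theta>"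
    and anti: "\<And>i \<theta> \<theta>'. V_kernel V A \<theta> \<Longrightarrow> V_kernel V A \<theta>' \<Longrightarrow> \<theta> \<subseteq> \<theta>' \<Longrightarrow> D i \<theta> \<Longrightarrow> D i \<theta>'"
  shows "\<exists>i\<in>I. \<forall>\<theta>. V_kernel V A \<theta> \<longrightarrow> D i \<theta>"
proof (rule ccontr)
  assume "\<not> ?thesis"
  then have "\<forall>i\<in>I. \<exists>\<theta>. V_kernel V A \<theta> \<and> \<not> D i \<theta>" by simp
  from bchoice[OF this] obtain \<theta> where \<theta>: "\<forall>i\<in>I. V_kernel V A (\<theta> i) \<and> \<not> D i (\<theta> i)" ..
  have k: "V_kernel V A (\<Inter>(\<theta> ` I))" using \<theta> I by (intro kernel_Inter[OF pv]) auto
  from ex[OF k] obtain i where i: "i \<in> I" "D i (\<Inter>(\<theta> ` I))" ..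
  have "D i (\<theta> i)" by (rule anti[OF k _ _ i(2)]) (use \<theta> i(1) in auto)
  then show False using \<theta> i(1) by simp
qed

text \<open>Says that modulo \<open>\<theta>\<close> the word \<open>w\<close> represents a
  \<open>t\<close> with \<open>ut = x\<close> and \<open>v = ty\<close>.\<close>

definition quotient_at where
  "quotient_at \<theta> u v x y w \<longleftrightarrow>
    (\<exists>U\<in>u \<theta>. \<exists>W\<in>v \<theta>. \<exists>X\<in>x \<theta>. \<exists>Y\<in>y \<theta>. (U @ w, X) \<in> \<theta> \<and> (W, w @ Y) \<in> \<theta>)"

lemma quotient_at_mono:
  assumes "u \<in> FV V A" "v \<in> FV V A" "x \<in> FV V A" "y \<in> FV V A"
    "V_kernel V A \<theta>" "V_kernel V A \<theta>'" "\<theta> \<subseteq> \<theta>'" "quotient_at \<theta> u v x y w"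
  shows "quotient_at \<theta>' u v x y w"
proof -
  obtain U W X Y where "U \<in> u \<theta>" "W \<in> v \<theta>" "X \<in> x \<theta>" "Y \<in> y \<theta>" and
    rel: "(U @ w, X) \<in> \<theta>" "(W, w @ Y) \<in> \<theta>"
    using assms(8) unfolding quotient_at_def by blast
  then have "U \<in> u \<theta>'" "W \<in> v \<theta>'" "X \<in> x \<theta>'" "Y \<in> y \<theta>'"
    using assms(1-4) by (auto elim!: FV_mono[OF _ assms(5-7)])
  then show ?thesis using rel assms(7) unfolding quotient_at_def by blast
qed

text \<open>Both equations are part of one condition on \<open>w\<close>, so compactness produces a
  single \<open>t\<close> satisfying both at every kernel.\<close>

lemma quotient_compact:
  assumes pv: "pseudovariety V"
    and mem: "u \<in> FV V A" "v \<in> FV V A" "x \<in> FV V A" "y \<in> FV V A"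
    and ex: "\<And>\<theta>. V_kernel V A \<theta> \<Longrightarrow> \<exists>w\<in>Aplus A. quotient_at \<theta> u v x y w"
  shows "\<exists>t\<in>FV V A. FVmult V A u t = x \<and> v = FVmult V A t y"
proof -
  have "\<exists>t\<in>FV V A. \<forall>\<theta>. V_kernel V A \<theta> \<longrightarrow> (\<exists>w\<in>t \<theta>. quotient_at \<theta> u v x y w)"
    by (rule FV_compact[OF pv ex], assumption) (rule quotient_at_mono[OF mem])
  then obtain t where t: "t \<in> FV V A"
    "\<And>\<theta>. V_kernel V A \<theta> \<Longrightarrow> \<exists>w\<in>t \<theta>. quotient_at \<theta> u v x y w" by blast
  have "FVmult V A u t = x"
  proof (rule FV_eqI)
    fix \<theta> assume k: "V_kernel V A \<theta>"
    obtain w U X where w: "w \<in> t \<theta>" "U \<in> u \<theta>" "X \<in> x \<theta>" "(U @ w, X) \<in> \<theta>"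
      using t(2)[OF k] by (auto simp: quotient_at_def)
    have "U @ w \<in> FVmult V A u t \<theta>" by (intro FVmult_mem mem t k w)
    moreover have "U @ w \<in> x \<theta>" using FV_closed[OF mem(3) k w(3)] kernel_sym[OF k w(4)] by blast
    ultimately show "\<exists>w. w \<in> FVmult V A u t \<theta> \<and> w \<in> x \<theta>" by blast
  qed (use mem t in auto)
  moreover have "v = FVmult V A t y"
  proof (rule FV_eqI)
    fix \<theta> assume k: "V_kernel V A \<theta>"
    obtain w W Y where w: "w \<in> t \<theta>" "Y \<in> y \<theta>" "W \<in> v \<theta>" "(W, w @ Y) \<in> \<theta>"
      using t(2)[OF k] by (auto simp: quotient_at_def)
    have "w @ Y \<in> FVmult V A t y \<theta>" by (intro FVmult_mem mem t k w)
    moreover have "w @ Y \<in> v \<theta>" using FV_closed[OF mem(2) k w(3) w(4)] .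
    ultimately show "\<exists>w. w \<in> v \<theta> \<and> w \<in> FVmult V A t y \<theta>" by blast
  qed (use mem t in auto)
  ultimately show ?thesis using t(1) by blast
qed

text \<open>Separates the case where \<open>t\<close> is the adjoined identity, which amounts to
  \<open>u = x\<close> and \<open>v = y\<close>; the remaining \<open>t\<close> lie in the semigroup
  itself.\<close>

lemma equidivisible_iff:
  "equidivisible C f \<longleftrightarrow> (\<forall>u\<in>C. \<forall>v\<in>C. \<forall>x\<in>C. \<forall>y\<in>C. f u v = f x y \<longrightarrow>
     (u = x \<and> v = y) \<or> (\<exists>t\<in>C. f u t = x \<and> v = f t y) \<or> (\<exists>t\<in>C. f x t = u \<and> y = f t v))"
  unfolding equidivisible_def S1_def mult1_def
  by (simp add: bex_disj_distrib) (simp only: eq_commute conj_commute disj_ac disj_left_absorb)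

lemma equidivisibleE:
  assumes "equidivisible C f" "u \<in> C" "v \<in> C" "x \<in> C" "y \<in> C" "f u v = f x y"
  obtains "u = x" "v = y" | t where "t \<in> C" "f u t = x" "v = f t y" | t where "t \<in> C" "f x t = u" "y = f t v"
proof -
  have "(u = x \<and> v = y) \<or> (\<exists>t\<in>C. f u t = x \<and> v = f t y) \<or> (\<exists>t\<in>C. f x t = u \<and> y = f t v)"
    using assms(1)[unfolded equidivisible_iff] assms(2-) by simp
  then show ?thesis using that by blast
qed

text \<open>A \<open>t\<close> found over \<open>B\<close> need not come from \<open>FV V A\<close>,
  but a word representing it modulo \<open>\<eta>\<close> lifts through the surjective substitution,
  and one coordinate is all that is asked.\<close>

lemma (in FV_substitution) quotient_at_pull:
  assumes k: "V_kernel V B \<eta>" and surj: "\<And>w. w \<in> Aplus B \<Longrightarrow> \<exists>v\<in>Aplus A. subst v = w"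
    and mem: "u \<in> FV V A" "v \<in> FV V A" "x \<in> FV V A" "y \<in> FV V A"
    and t: "t \<in> FV V B" "FVmult V B (push u) t = push x" "push v = FVmult V B t (push y)"
  shows "\<exists>w\<in>Aplus A. quotient_at (pull \<eta>) u v x y w"
proof -
  note kp = pull_kernel[OF k]
  obtain W where W: "W \<in> t \<eta>" "W \<in> Aplus B" using FV_nonempty[OF t(1) k] .
  obtain w where w: "w \<in> Aplus A" "subst w = W" using surj[OF W(2)] by blast
  obtain a where a: "a \<in> u (pull \<eta>)" "a \<in> Aplus A" using FV_nonempty[OF mem(1) kp] .
  obtain b where b: "b \<in> v (pull \<eta>)" "b \<in> Aplus A" using FV_nonempty[OF mem(2) kp] .
  obtain c where c: "c \<in> x (pull \<eta>)" "c \<in> Aplus A" using FV_nonempty[OF mem(3) kp] .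
  obtain d where d: "d \<in> y (pull \<eta>)" "d \<in> Aplus A" using FV_nonempty[OF mem(4) kp] .
  have "subst a @ W \<in> FVmult V B (push u) t \<eta>"
    by (intro FVmult_mem push_closed mem t(1) k push_mem a W)
  then have 1: "(subst (a @ w), subst c) \<in> \<eta>"
    using FV_rel[OF push_closed[OF mem(3)] k] push_mem[OF mem(3) k c(1)] t(2) w(2) by simp
  have "W @ subst d \<in> FVmult V B t (push y) \<eta>"
    by (intro FVmult_mem push_closed mem t(1) k push_mem d W)
  then have 2: "(subst b, subst (w @ d)) \<in> \<eta>"
    using FV_rel[OF push_closed[OF mem(2)] k push_mem[OF mem(2) k b(1)]] t(3) w(2) by simp
  have "(a @ w, c) \<in> pull \<eta>" "(b, w @ d) \<in> pull \<eta>"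
    using 1 2 w a b c d unfolding pull_def by (auto simp del: map_append concat_append)
  then show ?thesis using w(1) a(1) b(1) c(1) d(1) unfolding quotient_at_def by blast
qed

text \<open>At each kernel the equation is pushed to a finite alphabet, where one of three
  alternatives holds. Each alternative passes to coarser kernels, so by pigeonhole one of them holds
  at all kernels, and compactness glues the local solutions.\<close>

lemma FV_equidivisible:
  assumes pv: "pseudovariety V" and eq: "equidivisible_pv V"
  shows "equidivisible (FV V A) (FVmult V A)"
  unfolding equidivisible_iff
proof (intro ballI impI)
  fix u v x y assume mem: "u \<in> FV V A" "v \<in> FV V A" "x \<in> FV V A" "y \<in> FV V A"
    and e: "FVmult V A u v = FVmult V A x y"
  \<comment> \<open>The three alternatives at one coordinate: equal factors for 0, the divisor
    \<open>t\<close> in one direction for 1 and in the other for 2.\<close>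
  define D :: "nat \<Rightarrow> ('a list \<times> 'a list) set \<Rightarrow> bool" where "D i \<theta> \<longleftrightarrow>
    (if i = 0 then (\<exists>w. w \<in> u \<theta> \<and> w \<in> x \<theta>) \<and> (\<exists>w. w \<in> v \<theta> \<and> w \<in> y \<theta>)
     else if i = 1 then \<exists>w\<in>Aplus A. quotient_at \<theta> u v x y w
     else \<exists>w\<in>Aplus A. quotient_at \<theta> x y u v w)" for i \<theta>
  have "\<exists>i\<in>{0,1,2}. \<forall>\<theta>. V_kernel V A \<theta> \<longrightarrow> D i \<theta>"
  proof (rule FV_pigeonhole[OF pv])
    fix \<theta> assume "V_kernel V A \<theta>"
    then obtain B :: "nat set" and \<sigma> \<eta> where B: "finite B" "B \<noteq> {}" "FV_substitution V A B \<sigma>"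
      "V_kernel V B \<eta>" "FV_substitution.pull A \<sigma> \<eta> = \<theta>"
      "\<And>w. w \<in> Aplus B \<Longrightarrow> \<exists>v\<in>Aplus A. concat (map \<sigma> v) = w"
      by (rule kernel_from_finite_alphabet[OF pv]) (rule that)
    interpret FV_substitution V A B \<sigma> by fact
    note k = pull_kernel[OF B(4)]
    have eqB: "equidivisible (FV V B) (FVmult V B)" using eq B(1,2) by (simp add: equidivisible_pv_def)
    have "FVmult V B (push u) (push v) = FVmult V B (push x) (push y)"
      using e push_mult[OF mem(1,2)] push_mult[OF mem(3,4)] by simp
    then consider "push u = push x" "push v = push y"
      | t where "t \<in> FV V B" "FVmult V B (push u) t = push x" "push v = FVmult V B t (push y)"
      | t where "t \<in> FV V B" "FVmult V B (push x) t = push u" "push y = FVmult V B t (push v)"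
      by (rule equidivisibleE[OF eqB mem[THEN push_closed]]) (rule that; assumption)+
    then show "\<exists>i\<in>{0,1,2}. D i \<theta>"
    proof cases
      case 1
      have at: "\<exists>w. w \<in> a \<theta> \<and> w \<in> b \<theta>" if ab: "a \<in> FV V A" "b \<in> FV V A" "push a = push b" for a b
      proof -
        obtain c where c: "c \<in> a (pull \<eta>)" using FV_nonempty[OF ab(1) k] .
        obtain d where d: "d \<in> b (pull \<eta>)" using FV_nonempty[OF ab(2) k] .
        have "d \<in> a (pull \<eta>)"
          using FV_closed[OF ab(1) k c] push_eq_at[OF B(4) ab(1,2,3) c d] by blast
        with d show ?thesis using B(5) by blast
      qed
      show ?thesis using at[OF mem(1,3) 1(1)] at[OF mem(2,4) 1(2)] by (simp add: D_def)
    next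
      case (2 t)
      then show ?thesis using quotient_at_pull[OF B(4,6) mem 2] B(5) by (simp add: D_def)
    next
      case (3 t)
      then show ?thesis using quotient_at_pull[OF B(4,6) mem(3,4,1,2) 3] B(5) by (simp add: D_def)
    qed
  next
    fix i \<theta> \<theta>' assume k: "V_kernel V A \<theta>" "V_kernel V A \<theta>'" "\<theta> \<subseteq> \<theta>'" and "D i \<theta>"
    note m = FV_mono[OF _ k] and q = quotient_at_mono[OF _ _ _ _ k]
    consider "i = 0" | "i = 1" | "i \<noteq> 0" "i \<noteq> 1" by blast
    then show "D i \<theta>'"
    proof cases
      case 1
      then show ?thesis using \<open>D i \<theta>\<close> m[OF mem(1)] m[OF mem(2)] m[OF mem(3)] m[OF mem(4)]
        unfolding D_def by simp blast
    next
      case 2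
      then show ?thesis using \<open>D i \<theta>\<close> q[OF mem] unfolding D_def by auto
    next
      case 3
      then show ?thesis using \<open>D i \<theta>\<close> q[OF mem(3,4,1,2)] unfolding D_def by auto
    qed
  qed auto
  then consider "\<And>\<theta>. V_kernel V A \<theta> \<Longrightarrow> D 0 \<theta>" | "\<And>\<theta>. V_kernel V A \<theta> \<Longrightarrow> D 1 \<theta>"
    | "\<And>\<theta>. V_kernel V A \<theta> \<Longrightarrow> D 2 \<theta>" by blast
  then show "(u = x \<and> v = y) \<or> (\<exists>t\<in>FV V A. FVmult V A u t = x \<and> v = FVmult V A t y) \<or>
      (\<exists>t\<in>FV V A. FVmult V A x t = u \<and> y = FVmult V A t v)"
  proof cases
    case 1
    have "u = x" by (rule FV_eqI[OF mem(1,3)]) (use 1 in \<open>simp add: D_def\<close>)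
    moreover have "v = y" by (rule FV_eqI[OF mem(2,4)]) (use 1 in \<open>simp add: D_def\<close>)
    ultimately show ?thesis by blast
  next
    case 2
    then show ?thesis using quotient_compact[OF pv mem] by (simp add: D_def)
  next
    case 3
    then show ?thesis using quotient_compact[OF pv mem(3,4,1,2)] by (simp add: D_def)
  qed
qed

lemma FV_equidivisibleE:
  assumes "pseudovariety V" "equidivisible_pv V" "u \<in> FV V A" "v \<in> FV V A" "x \<in> FV V A" "y \<in> FV V A"
    "FVmult V A u v = FVmult V A x y"
  obtains "u = x" "v = y"
    | t where "t \<in> FV V A" "FVmult V A u t = x" "v = FVmult V A t y"
    | t where "t \<in> FV V A" "FVmult V A x t = u" "y = FVmult V A t v"
  by (rule equidivisibleE[OF FV_equidivisible[OF assms(1,2)], OF assms(3-7)]) (rule that; assumption)+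

section \<open>Stabilizers\<close>

text \<open>The elements of \<open>eSe\<close> without left multiple \<open>e\<close> form an ideal
  \<open>T\<close> of the subsemigroup \<open>insert e T\<close>. It contains \<open>s\<close> but
  not \<open>e\<close>, so collapsing \<open>T\<close> to 0 and sending \<open>e\<close> to 1 gives
  the semilattice.\<close>

lemma semilattice_in_pseudovariety:
  assumes pv: "pseudovariety V" and S: "(S, m) \<in> V" and e: "e \<in> S" "m e e = e"
    and s: "s \<in> S" "m e s = s" "m s e = s" "\<And>k. k \<in> S \<Longrightarrow> m k s \<noteq> e"
  shows "({0, 1}, (*)) \<in> V"
proof -
  have cl: "m a b \<in> S" if "a \<in> S" "b \<in> S" for a b
    using pseudovariety_fsgp[OF pv S] that by (simp add: is_fsgp_def)
  have as: "m (m a b) c = m a (m b c)" if "a \<in> S" "b \<in> S" "c \<in> S" for a b c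
    using pseudovariety_fsgp[OF pv S] that by (simp add: is_fsgp_def)
  define T where "T = {r \<in> S. m e r = r \<and> m r e = r \<and> (\<forall>k\<in>S. m k r \<noteq> e)}"
  have eT: "e \<notin> T" using e by (auto simp: T_def)
  have T: "m a b \<in> T" if "a = e \<or> a \<in> T" "b \<in> T" for a b
  proof -
    have ab: "a \<in> S" "b \<in> S" "m e a = a" "m b e = b" "\<forall>k\<in>S. m k b \<noteq> e"
      using that e by (auto simp: T_def)
    have "m k (m a b) \<noteq> e" if k: "k \<in> S" for k
      using ab cl[OF k ab(1)] as[OF k ab(1,2)] by metis
    then show ?thesis
      using ab cl[OF ab(1,2)] as[OF e(1) ab(1,2)] as[OF ab(1,2) e(1)] by (simp add: T_def)
  qed
  have Te: "m a e = a" if "a \<in> T" for a using that by (simp add: T_def)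
  have "(insert e T, m) \<in> V"
  proof (rule pseudovariety_sub[OF pv S])
    show "insert e T \<subseteq> S" using e by (auto simp: T_def)
    fix a b assume "a \<in> insert e T" "b \<in> insert e T"
    then show "m a b \<in> insert e T" using T[of a b] Te e by auto
  qed simp
  then have "((\<lambda>a. if a = e then 1 else 0) ` insert e T, (*)) \<in> V"
  proof (rule pseudovariety_image[OF pv])
    fix a b assume ab: "a \<in> insert e T" "b \<in> insert e T"
    show "(if m a b = e then 1 else 0) = (if a = e then 1 else 0) * (if b = e then 1 else (0::nat))"
    proof (cases "b \<in> T")
      case True
      then have "m a b \<in> T" using T[of a b] ab by auto
      then show ?thesis using True eT by auto
    next
      case False
      then have "b = e" using ab by simp
      then show ?thesis using ab Te e eT by auto
    qed
  qed
  moreover have "s \<in> T" using s by (simp add: T_def)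
  then have "(\<lambda>a. if a = e then 1 else (0::nat)) ` insert e T = {0, 1}"
    using eT by (auto intro!: image_eqI)
  ultimately show ?thesis by simp
qed

text \<open>A product avoids \<open>c\<close> iff both factors do, so the indicator of avoiding
  \<open>c\<close> is a morphism into the semilattice.\<close>

lemma avoid_letter_kernel:
  assumes "pseudovariety V" "({0, 1}, (*)) \<in> V" "A \<noteq> {}"
  shows "V_kernel V A {(u, v). u \<in> Aplus A \<and> v \<in> Aplus A \<and>
    (if c \<in> set u then 0 else 1::nat) = (if c \<in> set v then 0 else 1)}"
  by (rule kernelI[OF assms]) auto

text \<open>If the letter \<open>a\<close> were a product, then so would be \<open>01\<close> over \<open>{0, 1}\<close>, with both factors
  having full content; no refinement of this product against \<open>0 \<cdot> 1\<close> respects contents.\<close>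

lemma letter_irreducible:
  fixes A :: "'a set"
  assumes pv: "pseudovariety V" and eqv: "equidivisible_pv V" and sl: "({0, 1}, (*)) \<in> V"
    and a: "a \<in> A" and u: "u \<in> FV V A" and v: "v \<in> FV V A"
  shows "FVmult V A u v \<noteq> FVword V A [a]"
proof
  assume uv: "FVmult V A u v = FVword V A [a]"
  define B :: "nat set" where "B = {0, 1}"
  \<comment> \<open>Every letter is sent to the word 01, so every image under \<open>push\<close>
    contains both letters.\<close>
  interpret FV_substitution V A B "\<lambda>_. [0, 1]"
    by unfold_locales (use pv a in \<open>auto simp: Aplus_def B_def\<close>)
  have aA: "[a] \<in> Aplus A" using a by (simp add: Aplus_def)
  have BB: "[0] \<in> Aplus B" "[1] \<in> Aplus B" by (auto simp: Aplus_def B_def)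
  define \<eta> where "\<eta> c = {(u, v). u \<in> Aplus B \<and> v \<in> Aplus B \<and>
    (if c \<in> set u then 0 else 1::nat) = (if c \<in> set v then 0 else 1)}" for c
  have k: "V_kernel V B (\<eta> c)" for c
    unfolding \<eta>_def by (rule avoid_letter_kernel[OF pv sl]) (simp add: B_def)
  have content: "\<exists>w\<in>push x (\<eta> c). 0 \<in> set w \<and> 1 \<in> set w" if x: "x \<in> FV V A" for x c
  proof -
    obtain w where w: "w \<in> x (pull (\<eta> c))" "w \<in> Aplus A"
      using FV_nonempty[OF x pull_kernel[OF k]] .
    then have "0 \<in> set (subst w) \<and> 1 \<in> set (subst w)" by (auto simp: Aplus_def neq_Nil_conv)
    then show ?thesis using push_mem[OF x k w(1)] by blast
  qed
  have pushes: "push u \<in> FV V B" "push v \<in> FV V B" by (rule push_closed[OF u], rule push_closed[OF v])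
  have "FVmult V B (FVword V B [0]) (FVword V B [1]) = push (FVword V A [a])"
  proof (rule FV_eqI)
    fix \<eta> assume k: "V_kernel V B \<eta>"
    have "[0] @ [1] \<in> FVmult V B (FVword V B [0]) (FVword V B [1]) \<eta>"
      by (intro FVmult_mem FVword_closed FVword_mem BB k)
    moreover have "subst [a] \<in> push (FVword V A [a]) \<eta>"
      by (intro push_mem FVword_closed FVword_mem pull_kernel aA k)
    ultimately show "\<exists>w. w \<in> FVmult V B (FVword V B [0]) (FVword V B [1]) \<eta> \<and>
        w \<in> push (FVword V A [a]) \<eta>" by auto
  qed (intro FVmult_closed FVword_closed push_closed BB aA)+
  also have "\<dots> = FVmult V B (push u) (push v)" using push_mult[OF u v] uv by simp
  finally have eq: "FVmult V B (FVword V B [0]) (FVword V B [1]) = FVmult V B (push u) (push v)" .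
  \<comment> \<open>The kernel \<open>\<eta> c\<close> detects occurrences of \<open>c\<close>,
    which the letter \<open>d\<close> lacks.\<close>
  have no: "z \<noteq> FVword V B [d]"
    if z: "z \<in> FV V B" and w: "w \<in> z (\<eta> c)" "c \<in> set w" and d: "c \<noteq> d" "d \<in> B" for z c d w
  proof
    assume "z = FVword V B [d]"
    moreover have "[d] \<in> Aplus B" using d by (simp add: Aplus_def)
    ultimately have "[d] \<in> z (\<eta> c)" using FVword_mem[OF k] by blast
    then have "(w, [d]) \<in> \<eta> c" using FV_rel[OF z k w(1)] by blast
    then show False using w(2) d(1) by (simp add: \<eta>_def)
  qed
  have B01: "0 \<in> B" "1 \<in> B" by (auto simp: B_def)
  \<comment> \<open>Each alternative turns the letter 0 or 1 into an element having
    \<open>push u\<close> or \<open>push v\<close> as a factor, hence containing the other letter as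
    well.\<close>
  show False
  proof (rule FV_equidivisibleE[OF pv eqv _ _ pushes eq])
    assume "FVword V B [0] = push u"
    moreover obtain w where "w \<in> push u (\<eta> 1)" "1 \<in> set w" using content[OF u] by blast
    then have "push u \<noteq> FVword V B [0]" by (rule no[OF pushes(1)]) (use B01 in simp_all)
    ultimately show False by simp
  next
    fix t assume t: "t \<in> FV V B" "FVword V B [1] = FVmult V B t (push v)"
    obtain w where w: "w \<in> push v (\<eta> 0)" "0 \<in> set w" using content[OF v] by blast
    obtain w' where w': "w' \<in> t (\<eta> 0)" using FV_nonempty[OF t(1) k] .
    have "w' @ w \<in> FVmult V B t (push v) (\<eta> 0)" by (intro FVmult_mem t pushes k w w')
    then have "FVmult V B t (push v) \<noteq> FVword V B [1]"
      by (rule no[OF FVmult_closed[OF t(1) pushes(2)]]) (use w B01 in simp_all)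
    then show False using t(2) by simp
  next
    fix t assume t: "t \<in> FV V B" "FVmult V B (push u) t = FVword V B [0]"
    obtain w where w: "w \<in> push u (\<eta> 1)" "1 \<in> set w" using content[OF u] by blast
    obtain w' where w': "w' \<in> t (\<eta> 1)" using FV_nonempty[OF t(1) k] .
    have "w @ w' \<in> FVmult V B (push u) t (\<eta> 1)" by (intro FVmult_mem t pushes k w w')
    then have "FVmult V B (push u) t \<noteq> FVword V B [0]"
      by (rule no[OF FVmult_closed[OF pushes(1) t(1)]]) (use w B01 in simp_all)
    then show False using t(2) by simp
  qed (intro FVword_closed BB)+
qed

section \<open>Group elements of finite quotients\<close>

text \<open>Two powers of \<open>Y\<close> agree modulo \<open>\<theta>\<close> by finiteness.
  Multiplying by powers of \<open>C\<close> cancels the common part and yields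
  \<open>Y^(r+1) = Y\<close>, so \<open>Y\<close> generates a cyclic group in the quotient.\<close>

lemma group_element_at:
  assumes pv: "pseudovariety V" and k: "V_kernel V A \<theta>" and Y: "Y \<in> Aplus A" and C: "set C \<subseteq> A"
    and reg: "(C @ Y @ Y, Y) \<in> \<theta> \<or> (Y @ Y @ C, Y) \<in> \<theta>"
  obtains D where "set D \<subseteq> A" "(Y @ Y @ D, Y) \<in> \<theta>" "(D @ Y @ Y, Y) \<in> \<theta>"
proof -
  define P where "P w n = concat (replicate n w)" for w :: "'a list" and n
  have P0: "P w 0 = []" and P1: "P w (Suc n) = w @ P w n" and Padd: "P w (i + j) = P w i @ P w j" for w n i j
    by (simp_all add: P_def replicate_add)
  have P1': "P w (Suc n) = P w n @ w" for w n using Padd[of w n 1] by (simp add: P_def)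
  have YA: "set Y \<subseteq> A" using Y by (simp add: Aplus_def)
  have PA: "set (P w n) \<subseteq> A" if "set w \<subseteq> A" for w n using that by (auto simp: P_def)
  have PY: "P Y (Suc n) \<in> Aplus A" for n using PA[OF YA, of "Suc n"] Y by (auto simp: P1 Aplus_def)
  note trans = kernel_trans[OF k] and sym = kernel_sym[OF k] and ctx = kernel_context[OF k]
  have "\<not> inj (\<lambda>n. \<theta> `` {P Y (Suc n)})"
  proof
    assume "inj (\<lambda>n. \<theta> `` {P Y (Suc n)})"
    moreover have "range (\<lambda>n. \<theta> `` {P Y (Suc n)}) \<subseteq> Aplus A // \<theta>" using PY by (auto intro: quotientI)
    ultimately show False
      using finite_kernel_quotient[OF pv k] infinite_UNIV_nat by (meson finite_subset finite_imageD)
  qed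
  then obtain i j where ij: "i < j" "\<theta> `` {P Y (Suc i)} = \<theta> `` {P Y (Suc j)}"
    unfolding inj_def by (metis linorder_neqE_nat)
  then have ij_rel: "(P Y (Suc j), P Y (Suc i)) \<in> \<theta>"
    using kernel_refl[OF k PY] by auto
  define r where "r = j - i"
  have r: "r \<noteq> 0" and j: "Suc j = Suc i + r" "Suc j = r + Suc i" using ij(1) by (auto simp: r_def)
  have comm: "P Y n @ Y = Y @ P Y n" for n using P1[of Y n] P1'[of Y n] by simp
  have Yr: "(Y @ P Y r, Y) \<in> \<theta>"
    using reg
  proof
    assume C1: "(C @ Y @ Y, Y) \<in> \<theta>"
    \<comment> \<open>The innermost \<open>C @ Y @ Y\<close> collapses to \<open>Y\<close>, which
      lowers both exponents by one.\<close>
    have cancel: "(P C n @ P Y (Suc n), Y) \<in> \<theta>" for n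
    proof (induction n)
      case 0
      then show ?case using kernel_refl[OF k Y] by (simp add: P0 P1)
    next
      case (Suc n)
      have "(P C n @ (C @ Y @ Y) @ P Y n, P C n @ Y @ P Y n) \<in> \<theta>"
        by (rule ctx[OF C1]) (intro PA C YA)+
      then show ?case using Suc trans by (simp add: P1'[of C] P1[of Y])
    qed
    \<comment> \<open>With \<open>C^i\<close> in front, \<open>Y^(j+1)\<close> reduces to
      \<open>Y^(r+1)\<close> and \<open>Y^(i+1)\<close> reduces to \<open>Y\<close>.\<close>
    have 1: "(P C i @ P Y (Suc j) @ [], P C i @ P Y (Suc i) @ []) \<in> \<theta>"
      by (rule ctx[OF ij_rel]) (use PA[OF C] in auto)
    have 2: "([] @ (P C i @ P Y (Suc i)) @ P Y r, [] @ Y @ P Y r) \<in> \<theta>"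
      by (rule ctx[OF cancel]) (use PA[OF YA] in auto)
    have "P Y (Suc j) = P Y (Suc i) @ P Y r" by (simp only: j(1) Padd)
    then have "(Y @ P Y r, P C i @ P Y (Suc i)) \<in> \<theta>" using 1 sym[OF 2] trans by simp
    then show ?thesis using cancel trans by blast
  next
    assume C2: "(Y @ Y @ C, Y) \<in> \<theta>"
    have cancel: "(P Y (Suc n) @ P C n, Y) \<in> \<theta>" for n
    proof (induction n)
      case 0
      then show ?case using kernel_refl[OF k Y] by (simp add: P0 P1)
    next
      case (Suc n)
      have "(P Y n @ (Y @ Y @ C) @ P C n, P Y n @ Y @ P C n) \<in> \<theta>"
        by (rule ctx[OF C2]) (intro PA C YA)+
      then show ?case using Suc trans by (simp add: P1'[of Y] P1[of C])
    qed
    have 1: "([] @ P Y (Suc j) @ P C i, [] @ P Y (Suc i) @ P C i) \<in> \<theta>"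
      by (rule ctx[OF ij_rel]) (use PA[OF C] in auto)
    have 2: "(P Y r @ (P Y (Suc i) @ P C i) @ [], P Y r @ Y @ []) \<in> \<theta>"
      by (rule ctx[OF cancel]) (use PA[OF YA] in auto)
    have "P Y (Suc j) = P Y r @ P Y (Suc i)" by (simp only: j(2) Padd)
    then have "(Y @ P Y r, P Y (Suc i) @ P C i) \<in> \<theta>" using 1 sym[OF 2] trans comm by simp
    then show ?thesis using cancel trans by blast
  qed
  \<comment> \<open>The exponent is -1 modulo the period \<open>r\<close>, so \<open>D\<close> is
    the inverse of \<open>Y\<close> in its group.\<close>
  define D where "D = P Y (2 * r - 1)"
  have "Y @ D = P Y (r + r)" using P1[of Y "2 * r - 1"] r by (simp add: D_def mult_2)
  then have D: "Y @ Y @ D = (Y @ P Y r) @ P Y r" by (simp add: Padd)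
  have D': "D @ Y @ Y = Y @ Y @ D"
    unfolding D_def by (metis append_assoc comm)
  have "([] @ (Y @ P Y r) @ P Y r, [] @ Y @ P Y r) \<in> \<theta>"
    by (rule ctx[OF Yr]) (use PA[OF YA] in auto)
  then have "(Y @ Y @ D, Y) \<in> \<theta>" using Yr trans D by simp
  moreover have "set D \<subseteq> A" using PA[OF YA] by (simp add: D_def)
  ultimately show ?thesis using that D' by simp
qed

section \<open>Leaving an \<L>-upset along the suffixes of a word\<close>

text \<open>Deleting the letters of \<open>u\<close> from the left leads from outside
  \<open>L\<close> to inside it; \<open>a\<close> is the letter whose deletion first enters
  \<open>L\<close>.\<close>

lemma first_suffix_in:
  assumes "L v" "\<not> L (u @ v)"
  obtains p a q where "u = p @ a # q" "L (q @ v)" "\<not> L (a # q @ v)"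
  using assms(2)
proof (induction u arbitrary: thesis)
  case (Cons b u)
  show ?case
  proof (cases "L (u @ v)")
    case True
    then show ?thesis using Cons.prems(1)[of "[]" b u] Cons.prems(2) by simp
  next
    case False
    show ?thesis
    proof (rule Cons.IH[OF _ False])
      fix p a q assume "u = p @ a # q" "L (q @ v)" "\<not> L (a # q @ v)"
      then show thesis using Cons.prems(1)[of "b # p" a q] by simp
    qed
  qed
qed (use assms(1) in simp)

text \<open>The \<L>-preorder of the quotient by \<open>\<theta>\<close>, with identity adjoined
  since \<open>k\<close> may be empty.\<close>

definition L_above :: "('a list \<times> 'a list) set \<Rightarrow> 'a set \<Rightarrow> 'a list \<Rightarrow> 'a list \<Rightarrow> bool" where
  "L_above \<theta> A y w \<longleftrightarrow> (\<exists>k. set k \<subseteq> A \<and> (k @ w, y) \<in> \<theta>)"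

lemma L_above_cong:
  assumes k: "V_kernel V A \<theta>" and "(w, w') \<in> \<theta>" "L_above \<theta> A y w'"
  shows "L_above \<theta> A y w"
proof -
  obtain p where p: "set p \<subseteq> A" "(p @ w', y) \<in> \<theta>" using assms(3) by (auto simp: L_above_def)
  have "(p @ w, p @ w') \<in> \<theta>" using kernel_context[OF k assms(2) p(1), of "[]"] by simp
  then show ?thesis using p kernel_trans[OF k] unfolding L_above_def by blast
qed

lemma L_above_suffix:
  "set p \<subseteq> A \<Longrightarrow> L_above \<theta> A y (p @ w) \<Longrightarrow> L_above \<theta> A y w"
  unfolding L_above_def by (metis append_assoc le_sup_iff set_append)

text \<open>The letter at which the suffixes of \<open>xx = xxy\<close> leave the \<open>\<L>\<close>-upset of \<open>y\<close> modulo \<open>\<theta>\<close>;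
  the second copy of \<open>x\<close> only keeps the prefix \<open>p\<close> nonempty.\<close>

lemma descent_factorization:
  assumes pv: "pseudovariety V" and fin: "finite A" "A \<noteq> {}"
    and x: "x \<in> FV V A" and y: "y \<in> FV V A" and xy: "FVmult V A x y = x"
    and k: "V_kernel V A \<theta>" and X: "X \<in> x \<theta>" and Y: "Y \<in> y \<theta>" and below: "\<not> L_above \<theta> A Y X"
  obtains a p s S z where "a \<in> A" "p \<in> FV V A" "s \<in> FV V A"
    "FVmult V A (FVmult V A p (FVword V A [a])) s = FVmult V A x x"
    "S \<in> s \<theta>" "L_above \<theta> A Y S" "\<not> L_above \<theta> A Y (a # S)" "set z \<subseteq> A" "(S, z @ Y) \<in> \<theta>"
proof -
  define xx where "xx = FVmult V A x x"
  have xx: "xx \<in> FV V A" using x by (simp add: xx_def)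
  have xxy: "FVmult V A x (FVmult V A x y) = xx" by (simp add: xy xx_def)
  \<comment> \<open>Only the last conjunct varies with \<open>\<theta>'\<close>: the \<L>-conditions
    stay at the given \<open>\<theta>\<close>, while the factorization is wanted at all
    kernels.\<close>
  define Q where "Q a \<theta>' S \<longleftrightarrow> L_above \<theta> A Y S \<and> \<not> L_above \<theta> A Y (a # S) \<and>
    (\<exists>z. set z \<subseteq> A \<and> (S, z @ Y) \<in> \<theta>) \<and> (\<exists>P\<in>Aplus A. P @ a # S \<in> xx \<theta>')" for a \<theta>' S
  have Q_mono: "Q a \<theta>2 S" if "V_kernel V A \<theta>1" "V_kernel V A \<theta>2" "\<theta>1 \<subseteq> \<theta>2" "Q a \<theta>1 S" for a \<theta>1 \<theta>2 S
    using that(4) FV_mono[OF xx that(1-3)] unfolding Q_def by blast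
  have "\<exists>a\<in>A. \<forall>\<theta>'. V_kernel V A \<theta>' \<longrightarrow> (\<exists>S\<in>Aplus A. Q a \<theta>' S)"
  proof (rule FV_pigeonhole[OF pv fin])
    fix \<theta>' assume k': "V_kernel V A \<theta>'"
    \<comment> \<open>Representatives at the intersection serve \<open>\<theta>\<close> and
      \<open>\<theta>'\<close> at once.\<close>
    have ki: "V_kernel V A (\<theta> \<inter> \<theta>')" by (rule kernel_Int[OF pv k k'])
    obtain X' where X': "X' \<in> x (\<theta> \<inter> \<theta>')" "X' \<in> Aplus A" using FV_nonempty[OF x ki] .
    obtain Y' where Y': "Y' \<in> y (\<theta> \<inter> \<theta>')" "Y' \<in> Aplus A" using FV_nonempty[OF y ki] .
    have X'\<theta>: "X' \<in> x \<theta>" by (rule FV_mono[OF x ki k _ X'(1)]) simp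
    have Y'\<theta>: "Y' \<in> y \<theta>" by (rule FV_mono[OF y ki k _ Y'(1)]) simp
    have YY': "(Y', Y) \<in> \<theta>" using FV_rel[OF y k Y'\<theta> Y] .
    have "L_above \<theta> A Y Y'" using YY' unfolding L_above_def by (intro exI[of _ "[]"]) simp
    moreover have "\<not> L_above \<theta> A Y (X' @ Y')"
    proof
      assume "L_above \<theta> A Y (X' @ Y')"
      moreover have "X' @ Y' \<in> x \<theta>" using FVmult_mem[OF x y k X'\<theta> Y'\<theta>] by (simp add: xy)
      ultimately show False using L_above_cong[OF k FV_rel[OF x k X]] below by blast
    qed
    ultimately obtain P a Z where Z: "X' = P @ a # Z" "L_above \<theta> A Y (Z @ Y')"
      "\<not> L_above \<theta> A Y (a # Z @ Y')" by (rule first_suffix_in)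
    have sub: "set P \<subseteq> A" "a \<in> A" "set Z \<subseteq> A" using X'(2) Z(1) by (auto simp: Aplus_def)
    have "X' @ X' @ Y' \<in> xx (\<theta> \<inter> \<theta>')"
      unfolding xxy[symmetric] by (intro FVmult_mem FVmult_closed x y ki X' Y')
    then have "(X' @ P) @ a # (Z @ Y') \<in> xx (\<theta> \<inter> \<theta>')" using Z(1) by simp
    then have "(X' @ P) @ a # (Z @ Y') \<in> xx \<theta>'" by (rule FV_mono[OF xx ki k', rotated]) simp
    moreover have "X' @ P \<in> Aplus A" using X'(2) sub by (auto simp: Aplus_def)
    \<comment> \<open>The trailing \<open>Y'\<close> makes the suffix nonempty and, modulo
      \<open>\<theta>\<close>, a word ending in \<open>Y\<close>.\<close>
    moreover have "(Z @ Y', Z @ Y) \<in> \<theta>" using kernel_context[OF k YY' sub(3), of "[]"] by simp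
    ultimately have "Q a \<theta>' (Z @ Y')" using Z sub unfolding Q_def by blast
    moreover have "Z @ Y' \<in> Aplus A" using sub Y' by (auto simp: Aplus_def)
    ultimately show "\<exists>a\<in>A. \<exists>S\<in>Aplus A. Q a \<theta>' S" using sub(2) by blast
  next
    fix a \<theta>1 \<theta>2 assume "V_kernel V A \<theta>1" "V_kernel V A \<theta>2" "\<theta>1 \<subseteq> \<theta>2" "\<exists>S\<in>Aplus A. Q a \<theta>1 S"
    then show "\<exists>S\<in>Aplus A. Q a \<theta>2 S" using Q_mono by blast
  qed
  then obtain a where a: "a \<in> A" "\<And>\<theta>'. V_kernel V A \<theta>' \<Longrightarrow> \<exists>S\<in>Aplus A. Q a \<theta>' S" by blast
  have "\<exists>s\<in>FV V A. \<forall>\<theta>'. V_kernel V A \<theta>' \<longrightarrow> (\<exists>S\<in>s \<theta>'. Q a \<theta>' S)"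
    by (rule FV_compact[OF pv a(2)], assumption) (rule Q_mono)
  then obtain s where s: "s \<in> FV V A" "\<And>\<theta>'. V_kernel V A \<theta>' \<Longrightarrow> \<exists>S\<in>s \<theta>'. Q a \<theta>' S" by blast
  \<comment> \<open>A second compactness argument finds the prefix \<open>p\<close> once the suffix
    \<open>s\<close> has been fixed.\<close>
  define R where "R \<theta>' P \<longleftrightarrow> (\<exists>S\<in>s \<theta>'. P @ a # S \<in> xx \<theta>')" for \<theta>' P
  have "\<exists>p\<in>FV V A. \<forall>\<theta>'. V_kernel V A \<theta>' \<longrightarrow> (\<exists>P\<in>p \<theta>'. R \<theta>' P)"
  proof (rule FV_compact[OF pv])
    fix \<theta>' assume "V_kernel V A \<theta>'"
    from s(2)[OF this] show "\<exists>P\<in>Aplus A. R \<theta>' P" unfolding Q_def R_def by blast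
  next
    fix \<theta>1 \<theta>2 P assume k12: "V_kernel V A \<theta>1" "V_kernel V A \<theta>2" "\<theta>1 \<subseteq> \<theta>2" and "R \<theta>1 P"
    then show "R \<theta>2 P" using FV_mono[OF xx k12] FV_mono[OF s(1) k12] unfolding R_def by blast
  qed
  then obtain p where p: "p \<in> FV V A" "\<And>\<theta>'. V_kernel V A \<theta>' \<Longrightarrow> \<exists>P\<in>p \<theta>'. R \<theta>' P" by blast
  have aA: "[a] \<in> Aplus A" using a by (simp add: Aplus_def)
  have "FVmult V A (FVmult V A p (FVword V A [a])) s = xx"
  proof (rule FV_eqI)
    fix \<theta>' assume k': "V_kernel V A \<theta>'"
    obtain P S where PS: "P \<in> p \<theta>'" "S \<in> s \<theta>'" "P @ a # S \<in> xx \<theta>'"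
      using p(2)[OF k'] unfolding R_def by blast
    have "(P @ [a]) @ S \<in> FVmult V A (FVmult V A p (FVword V A [a])) s \<theta>'"
      by (intro FVmult_mem FVmult_closed FVword_closed FVword_mem p(1) s(1) aA k' PS)
    then show "\<exists>w. w \<in> FVmult V A (FVmult V A p (FVword V A [a])) s \<theta>' \<and> w \<in> xx \<theta>'"
      using PS(3) by auto
  qed (use p s aA xx in auto)
  moreover obtain S where S: "S \<in> s \<theta>" "Q a \<theta> S" using s(2)[OF k] by blast
  moreover obtain z where "set z \<subseteq> A" "(S, z @ Y) \<in> \<theta>" using S(2) unfolding Q_def by blast
  ultimately show ?thesis using that a(1) p(1) s(1) unfolding Q_def xx_def by blast
qed

section \<open>Idempotency over finite alphabets\<close>

text \<open>Of the alternatives of equidivisibility, the one making \<open>t\<close> a proper left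
  factor of \<open>a\<close> contradicts irreducibility; so \<open>a\<close> can be cancelled from
  the left.\<close>

lemma irreducible_letter_cancel:
  assumes pv: "pseudovariety V" and eqv: "equidivisible_pv V"
    and irr: "\<And>u v. u \<in> FV V A \<Longrightarrow> v \<in> FV V A \<Longrightarrow> FVmult V A u v \<noteq> a"
    and mem: "a \<in> FV V A" "s \<in> FV V A" "t \<in> FV V A" "r \<in> FV V A"
    and eq: "FVmult V A a s = FVmult V A t r"
  shows "(t = a \<and> s = r) \<or> (\<exists>k\<in>FV V A. FVmult V A a k = t \<and> s = FVmult V A k r)"
proof (rule FV_equidivisibleE[OF pv eqv mem eq])
  fix k assume "k \<in> FV V A" "FVmult V A t k = a"
  then show ?thesis using irr mem(3) by blast
qed (use irr in auto)

text \<open>The equation is checked at one kernel, where \<open>Y\<close> is a group element with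
  inverse \<open>D\<close>. If \<open>X\<close>, or else a suffix \<open>S\<close> of
  \<open>xx\<close>, is \<L>-above \<open>Y\<close> and fixed by \<open>Y\<close> on the right, then
  so is \<open>Y\<close>.\<close>

lemma finite_stab_idempotent:
  assumes pv: "pseudovariety V" and eqv: "equidivisible_pv V" and fin: "finite A" "A \<noteq> {}"
    and x: "x \<in> FV V A" and y: "y \<in> FV V A" and c: "c \<in> FV V A" and xy: "FVmult V A x y = x"
    and reg: "FVmult V A c (FVmult V A y y) = y \<or> FVmult V A y (FVmult V A y c) = y"
  shows "FVmult V A y y = y"
proof (rule FV_eqI)
  fix \<theta> assume k: "V_kernel V A \<theta>"
  note trans = kernel_trans[OF k] and sym = kernel_sym[OF k] and ctx = kernel_context[OF k]
  obtain X where X: "X \<in> x \<theta>" "X \<in> Aplus A" using FV_nonempty[OF x k] .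
  obtain Y where Y: "Y \<in> y \<theta>" "Y \<in> Aplus A" using FV_nonempty[OF y k] .
  obtain C where C: "C \<in> c \<theta>" "C \<in> Aplus A" using FV_nonempty[OF c k] .
  have sets: "set X \<subseteq> A" "set Y \<subseteq> A" "set C \<subseteq> A" using X Y C by (auto simp: Aplus_def)
  have XY: "(X @ Y, X) \<in> \<theta>" using FV_rel[OF x k _ X(1)] FVmult_mem[OF x y k X(1) Y(1)] by (simp add: xy)
  have "C @ Y @ Y \<in> FVmult V A c (FVmult V A y y) \<theta>" "Y @ Y @ C \<in> FVmult V A y (FVmult V A y c) \<theta>"
    by (intro FVmult_mem FVmult_closed x y c k X Y C)+
  then have "(C @ Y @ Y, Y) \<in> \<theta> \<or> (Y @ Y @ C, Y) \<in> \<theta>"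
    using reg FV_rel[OF y k _ Y(1)] by auto
  then obtain D where D: "set D \<subseteq> A" "(Y @ Y @ D, Y) \<in> \<theta>" "(D @ Y @ Y, Y) \<in> \<theta>"
    using group_element_at[OF pv k Y(2) sets(3)] by blast
  have "(Y @ Y, Y) \<in> \<theta>"
  proof (cases "L_above \<theta> A Y X")
    case True
    then obtain p where p: "set p \<subseteq> A" "(p @ X, Y) \<in> \<theta>" by (auto simp: L_above_def)
    have 1: "(p @ X @ Y, Y @ Y) \<in> \<theta>" using ctx[OF p(2), of "[]" Y] sets by simp
    have 2: "(p @ X @ Y, p @ X) \<in> \<theta>" using ctx[OF XY p(1), of "[]"] by simp
    show ?thesis using trans[OF sym[OF 1] trans[OF 2 p(2)]] .
  next
    case False
    \<comment> \<open>The word \<open>D @ Y @ Y @ D\<close> is reduced in two ways.\<close>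
    have YD: "(Y @ D, D @ Y) \<in> \<theta>"
    proof -
      have "(D @ Y @ Y @ D, Y @ D) \<in> \<theta>" using ctx[OF D(3), of "[]" D] D(1) by simp
      moreover have "(D @ Y @ Y @ D, D @ Y) \<in> \<theta>" using ctx[OF D(2) D(1), of "[]"] by simp
      ultimately show ?thesis using trans sym by blast
    qed
    have YDY: "(Y @ D @ Y, Y) \<in> \<theta>"
      using trans[OF _ D(3)] ctx[OF YD, of "[]" Y] sets by simp
    have E: "(Y @ D @ Y @ D, Y @ D) \<in> \<theta>" using ctx[OF YDY, of "[]" D] D(1) by simp
    \<comment> \<open>\<open>X @ Y @ Y @ D\<close> reduces to \<open>X @ Y @ D\<close> by absorbing
      the first \<open>Y\<close> into \<open>X\<close>, and to \<open>X\<close> by cancelling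
      \<open>D\<close>.\<close>
    have XYD: "(X @ Y @ D, X) \<in> \<theta>"
    proof -
      have 1: "(X @ Y @ Y @ D, X @ Y @ D) \<in> \<theta>" using ctx[OF XY, of "[]" "Y @ D"] sets D(1) by simp
      have 2: "(X @ Y @ Y @ D, X @ Y) \<in> \<theta>" using ctx[OF D(2) sets(1), of "[]"] by simp
      show ?thesis using trans[OF sym[OF 1] trans[OF 2 XY]] .
    qed
    have sl: "({0, 1}, (*)) \<in> V"
    proof -
      obtain S m h where h: "(S, m) \<in> V" "h ` Aplus A = S"
        "\<And>u v. u \<in> Aplus A \<Longrightarrow> v \<in> Aplus A \<Longrightarrow> h (u @ v) = m (h u) (h v)"
        "\<theta> = {(u, v). u \<in> Aplus A \<and> v \<in> Aplus A \<and> h u = h v}" by (rule kernelE[OF k]) (rule that)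
      \<comment> \<open>\<open>e\<close> is the identity of the group of \<open>Y\<close>, and
        \<open>s = eX\<close> satisfies \<open>se = s\<close> because \<open>X\<close> absorbs
        \<open>e\<close>. If \<open>ws = e\<close>, then right multiplication by \<open>Y\<close>
        gives \<open>ws = Y\<close>, so \<open>X\<close> would be \<L>-above
        \<open>Y\<close>.\<close>
      define e s where "e = Y @ D" and "s = Y @ D @ X"
      have es: "e \<in> Aplus A" "s \<in> Aplus A" using Y sets D(1) by (auto simp: e_def s_def Aplus_def)
      have rel: "h u = h v" if "(u, v) \<in> \<theta>" for u v using that h(4) by blast
      show ?thesis
      proof (rule semilattice_in_pseudovariety[OF pv h(1), of "h e" "h s"])
        show "m (h e) (h e) = h e" using rel[OF E] es h(3)[of e e] by (simp add: e_def)
        have "(Y @ D @ Y @ D @ X, Y @ D @ X) \<in> \<theta>" using ctx[OF E, of "[]" X] sets by simp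
        from rel[OF this] show "m (h e) (h s) = h s" using es h(3)[of e s] by (simp add: e_def s_def)
        have "(Y @ D @ X @ Y @ D, Y @ D @ X) \<in> \<theta>" using ctx[OF XYD, of "Y @ D" "[]"] sets D(1) by simp
        from rel[OF this] show "m (h s) (h e) = h s" using es h(3)[of s e] by (simp add: e_def s_def)
        fix r assume "r \<in> S"
        then obtain w where w: "w \<in> Aplus A" "r = h w" using h(2) by blast
        show "m r (h s) \<noteq> h e"
        proof
          assume "m r (h s) = h e"
          then have "(w @ s, e) \<in> \<theta>" using h(3)[OF w(1) es(2)] w es by (simp add: h(4))
          then have 1: "(w @ Y @ D @ X, Y @ D) \<in> \<theta>" by (simp add: e_def s_def)
          have wA: "set w \<subseteq> A" using w by (simp add: Aplus_def)
          have 2: "(w @ Y @ D @ X @ Y, Y @ D @ Y) \<in> \<theta>" using ctx[OF 1, of "[]" Y] sets by simp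
          have 3: "(w @ Y @ D @ X @ Y, w @ Y @ D @ X) \<in> \<theta>"
            using ctx[OF XY, of "w @ Y @ D" "[]"] wA sets D(1) by simp
          have "((w @ Y @ D) @ X, Y) \<in> \<theta>" using trans[OF sym[OF 3] trans[OF 2 YDY]] by simp
          moreover have "set (w @ Y @ D) \<subseteq> A" using wA sets D(1) by simp
          ultimately show False using False unfolding L_above_def by blast
        qed
      qed (use es h(2) in blast)+
    qed
    obtain a p s S z where *: "a \<in> A" "p \<in> FV V A" "s \<in> FV V A"
      "FVmult V A (FVmult V A p (FVword V A [a])) s = FVmult V A x x"
      "S \<in> s \<theta>" "L_above \<theta> A Y S" "\<not> L_above \<theta> A Y (a # S)" "set z \<subseteq> A" "(S, z @ Y) \<in> \<theta>"
      by (rule descent_factorization[OF pv fin x y xy k X(1) Y(1) False]) (rule that)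
    have aA: "[a] \<in> Aplus A" using *(1) by (simp add: Aplus_def)
    have SA: "set S \<subseteq> A" using FV_in_Aplus[OF *(3,5)] by (simp add: Aplus_def)
    \<comment> \<open>Left multiplication by \<open>D\<close> compensates for the extra
      \<open>Y\<close> on the right.\<close>
    have up: "L_above \<theta> A Y (S @ Y)"
    proof -
      obtain q where q: "set q \<subseteq> A" "(q @ S, Y) \<in> \<theta>" using *(6) by (auto simp: L_above_def)
      have "(D @ q @ S @ Y, D @ Y @ Y) \<in> \<theta>" using ctx[OF q(2) D(1), of Y] sets by simp
      then have "((D @ q) @ S @ Y, Y) \<in> \<theta>" using trans D(3) by simp
      moreover have "set (D @ q) \<subseteq> A" using D(1) q(1) by simp
      ultimately show ?thesis unfolding L_above_def by blast
    qed
    \<comment> \<open>As \<open>S\<close> ends in \<open>Y\<close> modulo \<open>\<theta>\<close>,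
      it is fixed by \<open>Y @ D\<close>; hence an equation for \<open>a # S @ Y\<close> yields one
      for \<open>a # S\<close> after multiplying by \<open>D\<close> on the right.\<close>
    have down: "\<not> L_above \<theta> A Y (a # S @ Y)"
    proof
      assume "L_above \<theta> A Y (a # S @ Y)"
      then obtain q where q: "set q \<subseteq> A" "(q @ a # S @ Y, Y) \<in> \<theta>" by (auto simp: L_above_def)
      have qa: "set (q @ [a]) \<subseteq> A" "set (q @ a # z) \<subseteq> A" using q *(1,8) by auto
      have 1: "(q @ a # S, q @ a # z @ Y) \<in> \<theta>" using ctx[OF *(9) qa(1), of "[]"] by simp
      have 2: "(q @ a # z @ Y @ Y @ D, q @ a # z @ Y) \<in> \<theta>" using ctx[OF D(2) qa(2), of "[]"] by simp
      have 3: "(q @ a # S @ Y @ D, q @ a # z @ Y @ Y @ D) \<in> \<theta>"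
        using ctx[OF *(9) qa(1), of "Y @ D"] sets D(1) by simp
      have 4: "(q @ a # S @ Y @ D, Y @ D) \<in> \<theta>" using ctx[OF q(2), of "[]" D] D(1) by simp
      have "(q @ a # S, Y @ D) \<in> \<theta>" using trans[OF 1 trans[OF sym[OF 2] trans[OF sym[OF 3] 4]]] .
      then have "(Y @ q @ a # S, Y @ Y @ D) \<in> \<theta>" using ctx[OF _ sets(2), of _ _ "[]"] by fastforce
      then have "((Y @ q) @ a # S, Y) \<in> \<theta>" using trans D(2) by simp
      moreover have "set (Y @ q) \<subseteq> A" using sets q(1) by simp
      ultimately show False using *(7) unfolding L_above_def by blast
    qed
    define l where "l = FVword V A [a]"
    have l: "l \<in> FV V A" "[a] \<in> l \<theta>" using FVword_mem[OF k aA] aA by (auto simp: l_def)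
    have irr: "FVmult V A u v \<noteq> l" if "u \<in> FV V A" "v \<in> FV V A" for u v
      using letter_irreducible[OF pv eqv sl *(1) that] by (simp add: l_def)
    note cancel = irreducible_letter_cancel[OF pv eqv irr l(1)]
    define r where "r = FVmult V A s y"
    have r: "r \<in> FV V A" "S @ Y \<in> r \<theta>" using FVmult_mem[OF *(3) y k *(5) Y(1)] *(3) y by (auto simp: r_def)
    have ls: "FVmult V A l s \<in> FV V A" "a # S \<in> FVmult V A l s \<theta>"
      using FVmult_mem[OF l(1) *(3) k l(2) *(5)] l *(3) by auto
    have lr: "FVmult V A l r \<in> FV V A" "a # S @ Y \<in> FVmult V A l r \<theta>"
      using FVmult_mem[OF l(1) r(1) k l(2) r(2)] l r by auto
    \<comment> \<open>The words \<L>-above \<open>Y\<close> are closed under suffixes, so no left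
      multiple of \<open>v\<close> is \<L>-above \<open>Y\<close> when \<open>v\<close> is
      not.\<close>
    have mult_no: False if "u = v \<or> (\<exists>t\<in>FV V A. u = FVmult V A t v)" and v: "v \<in> FV V A" "U \<in> v \<theta>"
      and u: "W \<in> u \<theta>" "u \<in> FV V A" "L_above \<theta> A Y W" "\<not> L_above \<theta> A Y U" for u v U W
      using that(1)
    proof
      assume "u = v"
      then show False using FV_rel[OF v(1) k v(2)] u L_above_cong[OF k] v(2) by metis
    next
      assume "\<exists>t\<in>FV V A. u = FVmult V A t v"
      then obtain t where t: "t \<in> FV V A" "u = FVmult V A t v" by blast
      obtain w where w: "w \<in> t \<theta>" "w \<in> Aplus A" using FV_nonempty[OF t(1) k] .
      have "w @ U \<in> u \<theta>" unfolding t(2) by (intro FVmult_mem t v k w)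
      then have "L_above \<theta> A Y (w @ U)" using L_above_cong[OF k FV_rel[OF u(2) k _ u(1)] u(3)] by blast
      moreover have "set w \<subseteq> A" using w by (simp add: Aplus_def)
      ultimately show False using L_above_suffix u(4) by blast
    qed
    \<comment> \<open>Both sides equal \<open>xx\<close>, which is fixed by \<open>y\<close> on the
      right.\<close>
    have "FVmult V A p (FVmult V A l s) = FVmult V A p (FVmult V A l r)"
    proof -
      have "FVmult V A p (FVmult V A l s) = FVmult V A x x"
        using *(2,3,4) l(1) by (simp add: l_def FVmult_assoc[symmetric])
      also have "\<dots> = FVmult V A (FVmult V A x x) y" using x y by (simp add: FVmult_assoc xy)
      also have "\<dots> = FVmult V A (FVmult V A (FVmult V A p l) s) y" using *(4) by (simp add: l_def)
      also have "\<dots> = FVmult V A p (FVmult V A l r)" using *(2,3) l(1) y by (simp add: r_def FVmult_assoc)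
      finally show ?thesis .
    qed
    \<comment> \<open>In the unequal cases, cancelling \<open>l\<close> makes \<open>s\<close> equal
      to or a left multiple of \<open>lr\<close>, or \<open>r\<close> of \<open>ls\<close>; but
      \<open>s\<close> and \<open>r\<close> are \<L>-above \<open>Y\<close> at
      \<open>\<theta>\<close> and \<open>ls\<close> and \<open>lr\<close> are not.\<close>
    then have "s = r"
    proof (rule FV_equidivisibleE[OF pv eqv *(2) ls(1) *(2) lr(1)])
      assume "FVmult V A l s = FVmult V A l r"
      from cancel[OF _ _ *(3) l(1) r(1) this] show ?thesis using irr l(1) by metis
    next
      fix t assume t: "t \<in> FV V A" "FVmult V A l s = FVmult V A t (FVmult V A l r)"
      from cancel[OF _ _ *(3) t(1) lr(1) t(2)]
      have "s = FVmult V A l r \<or> (\<exists>t\<in>FV V A. s = FVmult V A t (FVmult V A l r))" by blast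
      from mult_no[OF this lr *(5,3,6) down] show ?thesis ..
    next
      fix t assume t: "t \<in> FV V A" "FVmult V A l r = FVmult V A t (FVmult V A l s)"
      from cancel[OF _ _ r(1) t(1) ls(1) t(2)]
      have "r = FVmult V A l s \<or> (\<exists>t\<in>FV V A. r = FVmult V A t (FVmult V A l s))" by blast
      from mult_no[OF this ls r(2,1) up *(7)] show ?thesis ..
    qed
    then have SY: "(S @ Y, S) \<in> \<theta>" using FV_rel[OF *(3) k _ *(5)] r(2) by simp
    obtain q where q: "set q \<subseteq> A" "(q @ S, Y) \<in> \<theta>" using *(6) by (auto simp: L_above_def)
    have 1: "(q @ S @ Y, Y @ Y) \<in> \<theta>" using ctx[OF q(2), of "[]" Y] sets by simp
    have 2: "(q @ S @ Y, q @ S) \<in> \<theta>" using ctx[OF SY q(1), of "[]"] by simp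
    show ?thesis using trans[OF sym[OF 1] trans[OF 2 q(2)]] .
  qed
  moreover have "Y @ Y \<in> FVmult V A y y \<theta>" by (intro FVmult_mem y k Y)
  ultimately show "\<exists>w. w \<in> FVmult V A y y \<theta> \<and> w \<in> y \<theta>"
    using FV_closed[OF y k Y(1)] sym by blast
qed (use y in auto)

section \<open>Arbitrary alphabets and the stabilizer monoid\<close>

text \<open>Equidivisibility compares \<open>yt\<close> and \<open>ty\<close> after the common left
  factor \<open>x\<close>. With \<open>y = yty\<close>, each outcome makes \<open>y\<close> a left
  or right multiple of its square, and then the finite case applies kernel by kernel.\<close>

lemma stab_regular_idempotent:
  assumes pv: "pseudovariety V" and eqv: "equidivisible_pv V"
    and x: "x \<in> FV V A" and y: "y \<in> FV V A" and t: "t \<in> FV V A"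
    and xy: "FVmult V A x y = x" and xt: "FVmult V A x t = x"
    and yty: "FVmult V A (FVmult V A y t) y = y"
  shows "FVmult V A y y = y"
proof -
  let ?m = "FVmult V A"
  note as = FVmult_assoc
  have eq: "?m x (?m y t) = ?m x (?m t y)" using x y t xy xt by (simp add: as[symmetric])
  have "\<exists>c\<in>FV V A. ?m c (?m y y) = y \<or> ?m y (?m y c) = y"
  proof (rule FV_equidivisibleE[OF pv eqv x FVmult_closed[OF y t] x FVmult_closed[OF t y] eq])
    assume "?m y t = ?m t y"
    then have "?m t (?m y y) = y" using yty y t by (simp add: as)
    then show ?thesis using t by blast
  next
    fix k assume k: "k \<in> FV V A" "?m y t = ?m k (?m t y)"
    then have "?m (?m k t) (?m y y) = y" using yty y t by (simp add: as)
    then show ?thesis using k t by (meson FVmult_closed)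
  next
    fix k assume k: "k \<in> FV V A" "?m t y = ?m k (?m y t)"
    \<comment> \<open>Since \<open>yt\<close> is idempotent, its left multiple \<open>ty\<close> is
      fixed by \<open>yt\<close> on the right; multiplying by \<open>y\<close> on the left gives
      \<open>y = y(yt)\<close>, so \<open>c = t\<close>.\<close>
    have "?m (?m t y) (?m y t) = ?m (?m k (?m y t)) (?m y t)" by (simp only: k(2))
    also have "\<dots> = ?m k (?m (?m (?m y t) y) t)" using k(1) y t by (simp add: as)
    also have "\<dots> = ?m t y" using k(2) yty by simp
    finally have "?m (?m t y) (?m y t) = ?m t y" .
    then have "?m y (?m (?m t y) (?m y t)) = y" using yty y t by (simp add: as)
    moreover have "?m y (?m (?m t y) (?m y t)) = ?m (?m (?m y t) y) (?m y t)" using y t by (simp add: as)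
    ultimately show ?thesis using yty t by auto
  qed
  then obtain c where c: "c \<in> FV V A" "?m c (?m y y) = y \<or> ?m y (?m y c) = y" by blast
  show ?thesis
  proof (rule FV_eqI)
    fix \<theta> assume "V_kernel V A \<theta>"
    then obtain B :: "nat set" and \<sigma> \<eta> where B: "finite B" "B \<noteq> {}" "FV_substitution V A B \<sigma>"
      "V_kernel V B \<eta>" "FV_substitution.pull A \<sigma> \<eta> = \<theta>"
      "\<And>w. w \<in> Aplus B \<Longrightarrow> \<exists>v\<in>Aplus A. concat (map \<sigma> v) = w"
      by (rule kernel_from_finite_alphabet[OF pv]) (rule that)
    interpret FV_substitution V A B \<sigma> by fact
    have yy: "?m y y \<in> FV V A" using y by simp
    have "FVmult V B (push y) (push y) = push y"
    proof (rule finite_stab_idempotent[OF pv eqv B(1,2) push_closed[OF x] push_closed[OF y] push_closed[OF c(1)]])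
      show "FVmult V B (push x) (push y) = push x" using push_mult[OF x y] xy by simp
      show "FVmult V B (push c) (FVmult V B (push y) (push y)) = push y \<or>
          FVmult V B (push y) (FVmult V B (push y) (push c)) = push y"
        using c(2) push_mult[OF y y] push_mult[OF y c(1)] push_mult[OF c(1) yy] push_mult[OF y FVmult_closed[OF y c(1)]]
        by metis
    qed
    then have eq: "push (?m y y) = push y" using push_mult[OF y y] by simp
    note k = pull_kernel[OF B(4)]
    obtain u where u: "u \<in> ?m y y (pull \<eta>)" using FV_nonempty[OF yy k] .
    obtain v where v: "v \<in> y (pull \<eta>)" using FV_nonempty[OF y k] .
    have "v \<in> ?m y y (pull \<eta>)" using FV_closed[OF yy k u] push_eq_at[OF B(4) yy y eq u v] by blast
    then show "\<exists>w. w \<in> ?m y y \<theta> \<and> w \<in> y \<theta>" using v B(5) by blast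
  qed (use y in auto)
qed

theorem mainTheorem17:
  fixes V :: "(nat set \<times> (nat \<Rightarrow> nat \<Rightarrow> nat)) set" and A :: "'a set"
    and x :: "('a list \<times> 'a list) set \<Rightarrow> 'a list set"
  assumes "pseudovariety V" and "equidivisible_pv V" and "A \<noteq> {}"
    and "x \<in> FV V A"
  shows "internal_L_chain (FVmult V A) (Stab (FV V A) (FVmult V A) x) \<and>
    (\<forall>y\<in>Stab (FV V A) (FVmult V A) x.
       internally_regular (FVmult V A) (Stab (FV V A) (FVmult V A) x) y \<longrightarrow>
       mult1 (FVmult V A) y y = y)"
proof
  let ?f = "FVmult V A" and ?T = "Stab (FV V A) (FVmult V A) x"
  have T: "Some y \<in> ?T \<longleftrightarrow> y \<in> FV V A \<and> ?f x y = x" for y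
    by (auto simp: Stab_def S1_def mult1_def)
  have T0: "None \<in> ?T" by (simp add: Stab_def S1_def mult1_def)
  have unit: "mult1 ?f None y = y" "mult1 ?f y None = y" for y
    by (auto simp: mult1_def split: option.split)
  have pair: "mult1 ?f (Some a) (Some b) = Some (?f a b)" for a b by (simp add: mult1_def)
  show "internal_L_chain ?f ?T"
    unfolding internal_L_chain_def
  proof (intro ballI)
    fix y z assume y: "y \<in> ?T" and z: "z \<in> ?T"
    show "y \<in> (\<lambda>t. mult1 ?f t z) ` ?T \<union> {z} \<or> z \<in> (\<lambda>t. mult1 ?f t y) ` ?T \<union> {y}"
    proof (cases "y = None \<or> z = None")
      \<comment> \<open>Everything is a left multiple of the identity \<open>None\<close>.\<close>
      case True
      then show ?thesis using y z by (auto simp: unit)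
    next
      case False
      then obtain y' z' where yz: "y = Some y'" "z = Some z'" by (cases y; cases z) auto
      then have m: "y' \<in> FV V A" "z' \<in> FV V A" "?f x y' = ?f x z'" using y z T by auto
      \<comment> \<open>The \<open>t\<close> obtained satisfies \<open>xt = x\<close>, so it lies in
        the stabilizer; this makes the \<L>-comparison internal.\<close>
      show ?thesis
      proof (rule FV_equidivisibleE[OF assms(1,2,4) m(1) assms(4) m(2,3)])
        assume "y' = z'"
        then show ?thesis using yz by simp
      next
        fix t assume t: "t \<in> FV V A" "?f x t = x" "y' = ?f t z'"
        then have "Some t \<in> ?T" "y = mult1 ?f (Some t) z" using T yz pair by auto
        then show ?thesis by blast
      next
        fix t assume t: "t \<in> FV V A" "?f x t = x" "z' = ?f t y'"
        then have "Some t \<in> ?T" "z = mult1 ?f (Some t) y" using T yz pair by auto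
        then show ?thesis by blast
      qed
    qed
  qed
  show "\<forall>y\<in>?T. internally_regular ?f ?T y \<longrightarrow> mult1 ?f y y = y"
  proof (intro ballI impI)
    fix y assume "y \<in> ?T" "internally_regular ?f ?T y"
    then obtain t where t: "t \<in> ?T" "y = mult1 ?f (mult1 ?f y t) y" and y: "y \<in> ?T"
      by (auto simp: internally_regular_def)
    \<comment> \<open>For \<open>t = None\<close> the regularity equation is already
      \<open>y = yy\<close>.\<close>
    show "mult1 ?f y y = y"
    proof (cases "y = None \<or> t = None")
      case True
      then show ?thesis using t(2) by (auto simp: unit)
    next
      case False
      then obtain y' t' where yt: "y = Some y'" "t = Some t'" by (cases y; cases t) auto
      then have "?f (?f y' t') y' = y'" using t(2) by (simp add: pair)
      then have "?f y' y' = y'"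
        using stab_regular_idempotent[OF assms(1,2,4)] y t(1) yt T by blast
      then show ?thesis using yt by (simp add: pair)
    qed
  qed
qed

end
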